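(* The class $\mathcal{F}_<$ is a Ramsey class: for every $A,B\in\mathcal{F}_<$ and every natural number $r\ge2$ there exists $C\in\mathcal{F}_<$ such that for every colouring $c$ of the set of epimorphisms from $C$ onto $A$ with $r$ colours there exists an epimorphism $g:C\to B$ such that $\{f\circ g: f \text{ an epimorphism from } B \text{ onto } A\}$ is $c$-monochromatic.
   Context: A fan is a finite acyclic undirected connected simple graph with a distinguished vertex $r$ (the root) such that every vertex other than $r$ has degree at most $2$. It carries the tree order $\preceq$: $s\preceq t$ iff $s$ lies on the path from $t$ to the root; $t$ is an immediate successor of $s$ if $s\preceq t$, $s\ne t$ and no third vertex lies strictly between them. A branch is a maximal $\preceq$-chain; its height is its number of vertices minus one. $\mathcal{F}_<$ is the class of finite structures $(A,R^A,S^A)$ where $A$ is a fan all of whose branches have the same height, $R^A(s,t)$ holds iff $s=t$ or $t$ is an immediate successor of $s$, and for some enumeration $a_1<a_2<\cdots<a_n$ of the branches of $A$, $S^A(x,y)$ holds iff there are $i\le j$ with $x\in a_i$ and $y\in a_j$. An epimorphism $f:B\to A$ between such structures is a surjection such that for $Q\in\{R,S\}$ and all $x,y\in A$: $Q^A(x,y)$ holds iff there are $x',y'\in B$ with $f(x')=x$, $f(y')=y$ and $Q^B(x',y')$. $c$-monochromatic means $c$ is constant on the set. *)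

theory Defs
  imports "Graph_Theory.Graph_Theory" "HOL-Library.FuncSet"
begin

text \<open>
  Graphs are the symmetric loop-free finite digraphs without parallel arcs of the graph library
  (\<open>pair_graph\<close>): an undirected edge is a pair of opposite arcs. Consequently the walk
  \<open>a, b, a\<close> along a single edge is a \<open>cycle\<close> in the sense of the library. The cycles of the
  underlying undirected graph are the library cycles with at least three arcs, and the degree of
  a vertex in the undirected graph is its \<open>out_degree\<close>.
\<close>

definition undirected_acyclic :: "'a pair_pre_digraph \<Rightarrow> bool" where
  "undirected_acyclic G \<longleftrightarrow> \<not> (\<exists>p. pre_digraph.cycle (with_proj G) p \<and> length p \<ge> 3)"

definition fan :: "'a pair_pre_digraph \<Rightarrow> 'a \<Rightarrow> bool" where
  "fan G r \<longleftrightarrow> pair_graph G \<and> undirected_acyclic G \<and> connected (with_proj G) \<and> r \<in> pverts G \<and>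
     (\<forall>v \<in> pverts G. v \<noteq> r \<longrightarrow> out_degree (with_proj G) v \<le> 2)"

text \<open>In a fan the path \<open>p\<close> from \<open>t\<close> to the root is unique.\<close>

definition tree_le :: "'a pair_pre_digraph \<Rightarrow> 'a \<Rightarrow> 'a \<Rightarrow> 'a \<Rightarrow> bool" where
  "tree_le G r s t \<longleftrightarrow>
     (\<exists>p. pre_digraph.apath (with_proj G) t p r \<and>
          s \<in> set (pre_digraph.awalk_verts (with_proj G) t p))"

definition imm_succ :: "'a pair_pre_digraph \<Rightarrow> 'a \<Rightarrow> 'a \<Rightarrow> 'a \<Rightarrow> bool" where
  "imm_succ G r s t \<longleftrightarrow> tree_le G r s t \<and> s \<noteq> t \<and>
     \<not> (\<exists>u. u \<noteq> s \<and> u \<noteq> t \<and> tree_le G r s u \<and> tree_le G r u t)"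

definition branches :: "'a pair_pre_digraph \<Rightarrow> 'a \<Rightarrow> 'a set set" where
  "branches G r = {b. pred_on.maxchain (pverts G) (tree_le G r) b}"

definition height :: "'a set \<Rightarrow> nat" where
  "height b = card b - 1"

record 'a RS_structure =
  points :: "'a set"
  relR :: "'a rel"
  relS :: "'a rel"

text \<open>
  The list \<open>bs\<close> is an enumeration of the branches without repetition. The relations of a structure
  contain only pairs of elements of its domain.
\<close>

definition F_less :: "'a RS_structure set" where
  "F_less = {A. \<exists>G r. fan G r \<and> points A = pverts G \<and>
     (\<forall>a \<in> branches G r. \<forall>b \<in> branches G r. height a = height b) \<and>
     relR A = {(s, t). s \<in> points A \<and> t \<in> points A \<and> (s = t \<or> imm_succ G r s t)} \<and>
     (\<exists>bs. distinct bs \<and> set bs = branches G r \<and>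
        relS A = {(x, y). x \<in> points A \<and> y \<in> points A \<and>
          (\<exists>i j. i \<le> j \<and> j < length bs \<and> x \<in> bs ! i \<and> y \<in> bs ! j)})}"

definition reflects_onto :: "('b \<Rightarrow> 'a) \<Rightarrow> 'b set \<Rightarrow> 'b rel \<Rightarrow> 'a set \<Rightarrow> 'a rel \<Rightarrow> bool" where
  "reflects_onto f V Q V' Q' \<longleftrightarrow>
     (\<forall>x \<in> V'. \<forall>y \<in> V'. (x, y) \<in> Q' \<longleftrightarrow>
        (\<exists>x' \<in> V. \<exists>y' \<in> V. f x' = x \<and> f y' = y \<and> (x', y') \<in> Q))"

text \<open>
  \<open>epis B A\<close> is the set of epimorphisms from \<open>B\<close> onto \<open>A\<close>. They are taken extensional (equal to
  \<open>undefined\<close> outside \<open>points B\<close>), so that they correspond exactly to the maps defined on \<open>points B\<close>.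
\<close>

definition epis :: "'b RS_structure \<Rightarrow> 'a RS_structure \<Rightarrow> ('b \<Rightarrow> 'a) set" where
  "epis B A = {f \<in> extensional (points B). f ` points B = points A \<and>
     reflects_onto f (points B) (relR B) (points A) (relR A) \<and>
     reflects_onto f (points B) (relS B) (points A) (relS A)}"

definition monochromatic :: "('x \<Rightarrow> 'k) \<Rightarrow> 'x set \<Rightarrow> bool" where
  "monochromatic c H \<longleftrightarrow> (\<exists>k. \<forall>h \<in> H. c h = k)"

end

theory Submission
  imports Defs "HOL-Library.Sublist" "HOL-Analysis.Function_Topology"
begin

text \<open>
  An epimorphism from a fan with \<open>N\<close> branches of height \<open>M\<close> onto a fan \<open>A\<close> is a word of length \<open>N\<close>:
  its \<open>i\<close>-th letter names a branch of \<open>A\<close>, weakly increasing in \<open>i\<close>, and a nondecreasing step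
  function from heights to heights. Words form a semigroup under concatenation in which the heights
  of the second factor are shifted past those of the first, and step functions act on it by
  endomorphisms. As in the ultrafilter proof of Gowers' theorem, the Ellis--Numakura lemma yields
  ultrafilters \<open>w j\<close> on the words of height \<open>j\<close> with \<open>w i * w j = w (max i j)\<close> such that a step
  function \<open>p\<close> maps \<open>w j\<close> to \<open>w (p j)\<close>. For every epimorphism from \<open>B\<close> onto \<open>A\<close>, with branch labels
  \<open>a\<^sub>b\<close> and step functions \<open>p\<^sub>b\<close>, the product over \<open>b\<close> of the images of \<open>w K\<close> under \<open>(a\<^sub>b, p\<^sub>b)\<close>
  therefore collapses to one and the same ultrafilter. So \<open>w K\<close>-generic words \<open>x\<^sub>1, \<dots>, x\<^sub>m\<close>, one
  for each branch of \<open>B\<close>, give all these epimorphisms the same colour. A free ultrafilter on the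
  sizes \<open>N\<close> reduces the finite statement to this infinite one.
\<close>

text \<open>An epimorphism may take a branch of \<open>B\<close> only part of the way up a branch of
  \<open>A\<close>, so the product of images has factors of all heights in mixed order; hence
  absorption is needed on both sides. Factors with the same label merge into the maximum of their
  heights, and surjectivity forces this maximum to be the full height of \<open>A\<close> for every
  label: that is why the outcome does not depend on the epimorphism. Compatibility with all step
  functions has to hold at all heights simultaneously, so the Ellis-Numakura lemma is applied to
  whole sequences of ultrafilters with the pointwise product. It gives idempotents only inside a
  nonempty closed set; an explicit sequence, given by a single leg with generic jumps and generic
  height, starts the construction. Generic words have no bounded size, whereas a colouring refers to
  one fan; a word can nevertheless be read in every sufficiently large fan, because surplus branches
  can be sent to the root.\<close>

section \<open>Compactness and continuity for predicate transformers\<close>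

instance "fun" :: (type, t2_space) t2_space
proof
  fix f g :: "'a \<Rightarrow> 'b"
  assume "f \<noteq> g"
  then obtain x where "f x \<noteq> g x" by auto
  then obtain U V where UV: "open U" "open V" "f x \<in> U" "g x \<in> V" "U \<inter> V = {}"
    by (meson hausdorff)
  have "continuous_on UNIV (\<lambda>h :: 'a \<Rightarrow> 'b. h x)" by simp
  then have "open ((\<lambda>h :: 'a \<Rightarrow> 'b. h x) -` U)" "open ((\<lambda>h :: 'a \<Rightarrow> 'b. h x) -` V)"
    using UV by (simp_all add: open_vimage)
  moreover have "(\<lambda>h :: 'a \<Rightarrow> 'b. h x) -` U \<inter> (\<lambda>h :: 'a \<Rightarrow> 'b. h x) -` V = {}"
    using UV by auto
  ultimately show "\<exists>U V. open U \<and> open V \<and> f \<in> U \<and> g \<in> V \<and> U \<inter> V = {}"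
    using UV by (metis vimage_eq)
qed

lemma compact_UNIV_fun:
  assumes "compact (UNIV :: 'b::topological_space set)"
  shows "compact (UNIV :: ('a \<Rightarrow> 'b) set)"
proof -
  have "compact_space (euclidean :: 'b topology)"
    using assms by (simp add: compact_space_def)
  then have "compact_space (product_topology (\<lambda>_ :: 'a. (euclidean :: 'b topology)) UNIV)"
    by (simp add: compact_space_product_topology)
  then show ?thesis
    unfolding euclidean_product_topology by (simp add: compact_space_def)
qed

lemma compact_UNIV_bool: "compact (UNIV :: bool set)"
  by (simp add: finite_imp_compact)

text \<open>The type \<open>bool\<close> is discrete, so continuity amounts to clopenness. Boolean
  combinations of coordinates are therefore continuous, and equations between them cut out closed
  sets.\<close>

lemma continuous_on_bool_iff:
  "continuous_on UNIV (F :: 'a::topological_space \<Rightarrow> bool) \<longleftrightarrow> open {x. F x} \<and> open {x. \<not> F x}"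
proof
  assume "continuous_on UNIV F"
  then have "open (F -` {True})" "open (F -` {False})"
    by (auto intro: open_vimage open_discrete)
  moreover have "F -` {True} = {x. F x}" "F -` {False} = {x. \<not> F x}" by auto
  ultimately show "open {x. F x} \<and> open {x. \<not> F x}" by simp
next
  assume F: "open {x. F x} \<and> open {x. \<not> F x}"
  have "F -` B = (if True \<in> B then {x. F x} else {}) \<union> (if False \<in> B then {x. \<not> F x} else {})" for B
    by (auto simp: set_eq_iff) (metis (full_types))+
  then show "continuous_on UNIV F"
    using F by (simp add: continuous_on_open_vimage open_Un)
qed

lemma continuous_on_conj_bool:
  assumes "continuous_on UNIV (F :: 'a::topological_space \<Rightarrow> bool)" "continuous_on UNIV G"
  shows "continuous_on UNIV (\<lambda>x. F x \<and> G x)"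
proof -
  have "open {x. F x \<and> G x}" "open {x. \<not> F x \<or> \<not> G x}"
    using assms by (auto simp only: continuous_on_bool_iff intro: open_Collect_conj open_Collect_disj)
  then show ?thesis by (simp only: continuous_on_bool_iff de_Morgan_conj)
qed

lemma continuous_on_neg_bool:
  assumes "continuous_on UNIV (F :: 'a::topological_space \<Rightarrow> bool)"
  shows "continuous_on UNIV (\<lambda>x. \<not> F x)"
  using assms unfolding continuous_on_bool_iff by simp

section \<open>Idempotents\<close>

text \<open>For \<open>e\<close> in a minimal compact subsemigroup \<open>M\<close>, the set
  \<open>M e\<close> is again a compact subsemigroup by continuity in the left factor, so it is all
  of \<open>M\<close>. Hence the solutions of \<open>x e = e\<close> in \<open>M\<close> form a
  nonempty compact subsemigroup, which is \<open>M\<close> again and contains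
  \<open>e\<close>.\<close>

lemma Ellis_idempotent:
  fixes T :: "'a::t2_space set" and f :: "'a \<Rightarrow> 'a \<Rightarrow> 'a"
  assumes "compact T" "T \<noteq> {}"
    and closed: "\<And>x y. x \<in> T \<Longrightarrow> y \<in> T \<Longrightarrow> f x y \<in> T"
    and assoc: "\<And>x y z. f (f x y) z = f x (f y z)"
    and cont: "\<And>y. continuous_on UNIV (\<lambda>x. f x y)"
  shows "\<exists>e \<in> T. f e e = e"
proof -
  define \<S> where "\<S> = {A. A \<subseteq> T \<and> A \<noteq> {} \<and> compact A \<and> (\<forall>x \<in> A. \<forall>y \<in> A. f x y \<in> A)}"
  \<comment> \<open>Zorn's lemma yields maximal sets, so it is applied to complements in order to
    get a minimal subsemigroup.\<close>
  have "\<exists>M \<in> uminus ` \<S>. \<forall>X \<in> uminus ` \<S>. M \<subseteq> X \<longrightarrow> X = M"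
  proof (rule Zorn_Lemma2, intro ballI)
    fix \<C> assume C: "\<C> \<in> chains (uminus ` \<S>)"
    show "\<exists>U \<in> uminus ` \<S>. \<forall>X \<in> \<C>. X \<subseteq> U"
    proof (cases "\<C> = {}")
      case True
      then show ?thesis using assms(1,2) closed by (auto simp: \<S>_def)
    next
      case False
      define \<D> where "\<D> = uminus ` \<C>"
      have D: "\<D> \<subseteq> \<S>" "\<D> \<noteq> {}"
        using C False by (auto simp: \<D>_def chains_def chain_subset_def)
      have tot: "X \<subseteq> Y \<or> Y \<subseteq> X" if "X \<in> \<D>" "Y \<in> \<D>" for X Y
        using that C unfolding \<D>_def chains_def chain_subset_def by blast
      have fin: "\<exists>X \<in> F. \<Inter>F = X" if "finite F" "F \<noteq> {}" "F \<subseteq> \<D>" for F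
        using that
      proof (induction F rule: finite_ne_induct)
        case (insert X F)
        then obtain Y where "Y \<in> F" "\<Inter>F = Y" by auto
        then have "X \<inter> Y = X \<or> X \<inter> Y = Y" using tot[of X Y] insert by blast
        then show ?case using \<open>Y \<in> F\<close> \<open>\<Inter>F = Y\<close> by auto
      qed auto
      obtain X0 where X0: "X0 \<in> \<D>" using D by auto
      have "X0 \<inter> \<Inter>\<D> \<noteq> {}"
      proof (rule compact_imp_fip)
        show "compact X0" using X0 D by (auto simp: \<S>_def)
        show "closed X" if "X \<in> \<D>" for X using that D by (auto simp: \<S>_def compact_imp_closed)
        show "X0 \<inter> \<Inter>F \<noteq> {}" if "finite F" "F \<subseteq> \<D>" for F
          using fin[of "insert X0 F"] that X0 D by (force simp: \<S>_def)
      qed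
      then have "\<Inter>\<D> \<noteq> {}" by auto
      moreover have "compact (\<Inter>\<D>)"
      proof -
        have "compact (X0 \<inter> \<Inter>\<D>)"
          using D X0 by (intro compact_Int_closed closed_Inter) (auto simp: \<S>_def compact_imp_closed)
        moreover have "X0 \<inter> \<Inter>\<D> = \<Inter>\<D>" using X0 by auto
        ultimately show ?thesis by simp
      qed
      moreover have "\<Inter>\<D> \<subseteq> T" using X0 D unfolding \<S>_def by blast
      moreover have "\<forall>x \<in> \<Inter>\<D>. \<forall>y \<in> \<Inter>\<D>. f x y \<in> \<Inter>\<D>"
      proof (intro ballI InterI)
        fix x y X assume "x \<in> \<Inter>\<D>" "y \<in> \<Inter>\<D>" "X \<in> \<D>"
        moreover have "X \<in> \<S>" using D \<open>X \<in> \<D>\<close> by auto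
        ultimately show "f x y \<in> X" by (simp add: \<S>_def)
      qed
      ultimately have "\<Inter>\<D> \<in> \<S>" by (simp add: \<S>_def)
      then have 1: "- \<Inter>\<D> \<in> uminus ` \<S>" by (rule imageI)
      have 2: "\<forall>X \<in> \<C>. X \<subseteq> - \<Inter>\<D>"
      proof
        fix X assume "X \<in> \<C>"
        then have "- X \<in> \<D>" by (simp add: \<D>_def)
        then show "X \<subseteq> - \<Inter>\<D>" by blast
      qed
      show ?thesis
        using 2 by (rule bexI[where P = "\<lambda>U. \<forall>X \<in> \<C>. X \<subseteq> U"]) (rule 1)
    qed
  qed
  then obtain M0 where M0: "M0 \<in> uminus ` \<S>" "\<forall>X \<in> uminus ` \<S>. M0 \<subseteq> X \<longrightarrow> X = M0"
    by (rule bexE)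
  define M where "M = - M0"
  have M: "M \<in> \<S>" using M0(1) by (auto simp: M_def)
  then have MT: "M \<subseteq> T" and "M \<noteq> {}" and compM: "compact M"
    and fM: "\<And>x y. x \<in> M \<Longrightarrow> y \<in> M \<Longrightarrow> f x y \<in> M"
    by (simp_all add: \<S>_def)
  have Mmin: "X = M"
    if "X \<subseteq> M" "X \<noteq> {}" "compact X" "\<And>x y. x \<in> X \<Longrightarrow> y \<in> X \<Longrightarrow> f x y \<in> X" for X
  proof -
    have "X \<in> \<S>" using that MT by (simp add: \<S>_def)
    moreover have "M0 \<subseteq> - X" using that(1) by (auto simp: M_def)
    ultimately have "- X = M0" using M0(2) by (meson imageI)
    then show ?thesis by (auto simp: M_def)
  qed
  obtain e where e: "e \<in> M" using \<open>M \<noteq> {}\<close> by auto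
  have "(\<lambda>x. f x e) ` M = M"
  proof (rule Mmin)
    show "(\<lambda>x. f x e) ` M \<subseteq> M" using fM e by auto
    show "compact ((\<lambda>x. f x e) ` M)"
      by (rule compact_continuous_image[OF continuous_on_subset[OF cont] compM]) simp
    fix x y assume "x \<in> (\<lambda>x. f x e) ` M" and "y \<in> (\<lambda>x. f x e) ` M"
    then obtain x' y' where "x' \<in> M" "y' \<in> M" "x = f x' e" "y = f y' e" by (elim imageE)
    then have "f x y = f (f (f x' e) y') e" "f (f x' e) y' \<in> M"
      using fM e by (simp_all add: assoc)
    then show "f x y \<in> (\<lambda>x. f x e) ` M" by (rule image_eqI)
  qed (use e in auto)
  then have "e \<in> (\<lambda>x. f x e) ` M" using e by simp
  then obtain z where z: "z \<in> M" "e = f z e" by (elim imageE)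
  have cl: "closed {x. f x e = e}"
    by (rule closed_Collect_eq[OF cont continuous_on_const])
  have "M \<inter> {x. f x e = e} = M"
    by (rule Mmin) (use z fM compact_Int_closed[OF compM cl] in \<open>auto simp: assoc\<close>)
  then show ?thesis using e MT by blast
qed

section \<open>Ultrafilters\<close>

text \<open>An ultrafilter is represented by the predicate transformer ``for almost all \<open>x\<close>''.\<close>

definition ultra :: "(('a \<Rightarrow> bool) \<Rightarrow> bool) \<Rightarrow> bool" where
  "ultra u \<longleftrightarrow> (\<forall>P. u (\<lambda>x. \<not> P x) = (\<not> u P)) \<and> (\<forall>P Q. u (\<lambda>x. P x \<and> Q x) = (u P \<and> u Q))"

lemma ultra_not: "ultra u \<Longrightarrow> u (\<lambda>x. \<not> P x) = (\<not> u P)"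
  and ultra_conj: "ultra u \<Longrightarrow> u (\<lambda>x. P x \<and> Q x) = (u P \<and> u Q)"
  by (auto simp: ultra_def)

lemma ultra_conjI: "ultra u \<Longrightarrow> u P \<Longrightarrow> u Q \<Longrightarrow> u (\<lambda>x. P x \<and> Q x)"
  by (simp add: ultra_conj)

text \<open>The definition has no clause for constants: \<open>u\<close> holding of the false
  predicate would, by the conjunction clause, make it hold of the true one, against the negation
  clause.\<close>

lemma ultra_const:
  assumes "ultra u"
  shows "u (\<lambda>x. b) = b"
proof -
  have "\<not> u (\<lambda>x. False)"
    using ultra_conj[OF assms, of "\<lambda>_. False" "\<lambda>_. True"] ultra_not[OF assms, of "\<lambda>_. True"]
    by auto
  then show ?thesis
    using ultra_not[OF assms, of "\<lambda>_. False"] by (cases b) auto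
qed

lemma ultra_mono:
  assumes "ultra u" "u P" "\<And>x. P x \<Longrightarrow> Q x"
  shows "u Q"
proof -
  have "(\<lambda>x. P x \<and> Q x) = P" using assms(3) by auto
  then show ?thesis using ultra_conj[OF assms(1), of P Q] assms(2) by auto
qed

lemma ultra_cong:
  assumes "ultra u" "u R" "\<And>x. R x \<Longrightarrow> P x = Q x"
  shows "u P = u Q"
proof -
  have "(\<lambda>x. R x \<and> P x) = (\<lambda>x. R x \<and> Q x)" using assms(3) by auto
  then show ?thesis using ultra_conj[OF assms(1), of R P] ultra_conj[OF assms(1), of R Q] assms(2) by auto
qed

lemma ultra_ex: "ultra u \<Longrightarrow> u P \<Longrightarrow> \<exists>x. P x"
  by (metis (mono_tags) ultra_const ultra_mono)

lemma ultra_finite_ball: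
  assumes "ultra u" "finite I"
  shows "u (\<lambda>x. \<forall>i \<in> I. P i x) = (\<forall>i \<in> I. u (P i))"
  using assms(2) by induction (simp_all add: ultra_const[OF assms(1)] ultra_conj[OF assms(1)])

lemma ultra_finite_colour:
  assumes "ultra u" "u (\<lambda>x. f x < (r :: nat))"
  shows "\<exists>k < r. u (\<lambda>x. f x = k)"
proof (rule ccontr)
  assume "\<not> ?thesis"
  then have "\<forall>k \<in> {..<r}. u (\<lambda>x. f x \<noteq> k)" by (simp add: ultra_not[OF assms(1)])
  then have "u (\<lambda>x. \<forall>k \<in> {..<r}. f x \<noteq> k)" by (simp add: ultra_finite_ball[OF assms(1)])
  then have "u (\<lambda>x. f x < r \<and> (\<forall>k \<in> {..<r}. f x \<noteq> k))"
    unfolding ultra_conj[OF assms(1)] using assms(2) by blast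
  then show False using ultra_ex[OF assms(1)] by blast
qed

lemma ultra_principal: "ultra (\<lambda>P. P x)"
  by (simp add: ultra_def)

text \<open>For fixed \<open>P\<close> and \<open>Q\<close> each clause compares finitely many
  coordinates of \<open>u\<close>.\<close>

lemma closed_ultra: "closed {u :: ('a \<Rightarrow> bool) \<Rightarrow> bool. ultra u}"
  unfolding ultra_def
  by (intro closed_Collect_conj closed_Collect_all closed_Collect_eq continuous_on_conj_bool
      continuous_on_neg_bool continuous_on_product_coordinates)

text \<open>Finitely many tail conditions hold for the principal ultrafilter at a large number;
  compactness satisfies them all at once.\<close>

lemma free_ultrafilter_ex: "\<exists>F :: (nat \<Rightarrow> bool) \<Rightarrow> bool. ultra F \<and> (\<forall>m. F (\<lambda>n. m \<le> n))"
proof -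
  define \<C> where "\<C> m = {F :: (nat \<Rightarrow> bool) \<Rightarrow> bool. ultra F \<and> F (\<lambda>n. m \<le> n)}" for m :: nat
  have closed: "closed (\<C> m)" for m
  proof -
    have "{F :: (nat \<Rightarrow> bool) \<Rightarrow> bool. F (\<lambda>n. m \<le> n)} = {F. F (\<lambda>n. m \<le> n) = True}" by auto
    moreover have "closed \<dots>"
      by (intro closed_Collect_eq continuous_on_product_coordinates continuous_on_const)
    ultimately show ?thesis
      unfolding \<C>_def by (intro closed_Collect_conj closed_ultra) simp
  qed
  have "UNIV \<inter> (\<Inter>m \<in> UNIV. \<C> m) \<noteq> {}"
  proof (rule compact_imp_fip_image)
    show "compact (UNIV :: ((nat \<Rightarrow> bool) \<Rightarrow> bool) set)"
      by (intro compact_UNIV_fun compact_UNIV_bool)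
    fix I :: "nat set" assume "finite I"
    then obtain m where "\<forall>i \<in> I. i \<le> m" using finite_nat_set_iff_bounded_le by auto
    then have "(\<lambda>P. P m) \<in> (\<Inter>i \<in> I. \<C> i)" by (auto simp: \<C>_def ultra_principal)
    then show "UNIV \<inter> (\<Inter>i \<in> I. \<C> i) \<noteq> {}" by auto
  qed (use closed in auto)
  then show ?thesis by (auto simp: \<C>_def)
qed

definition push :: "('a \<Rightarrow> 'b) \<Rightarrow> (('a \<Rightarrow> bool) \<Rightarrow> bool) \<Rightarrow> ('b \<Rightarrow> bool) \<Rightarrow> bool" where
  "push f u P = u (\<lambda>x. P (f x))"

lemma ultra_push: "ultra u \<Longrightarrow> ultra (push f u)"
  by (simp add: ultra_def push_def)

lemma push_push: "push f (push g u) = push (f \<circ> g) u"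
  by (simp add: push_def fun_eq_iff)

text \<open>Fubini power of \<open>u\<close>. The head of the list is quantified outermost, so each
  later entry is generic relative to all earlier ones.\<close>

primrec iter_lim :: "(('a \<Rightarrow> bool) \<Rightarrow> bool) \<Rightarrow> nat \<Rightarrow> ('a list \<Rightarrow> bool) \<Rightarrow> bool" where
  "iter_lim u 0 P = P []"
| "iter_lim u (Suc m) P = u (\<lambda>x. iter_lim u m (\<lambda>xs. P (x # xs)))"

lemma ultra_iter_lim: "ultra u \<Longrightarrow> ultra (iter_lim u m)"
proof (induction m)
  case (Suc m)
  then show ?case by (simp add: ultra_def)
qed (simp add: ultra_def)

lemma iter_lim_all:
  assumes "ultra u" "u P"
  shows "iter_lim u m (\<lambda>xs. length xs = m \<and> (\<forall>x \<in> set xs. P x))"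
proof (induction m)
  case (Suc m)
  have "iter_lim u m (\<lambda>xs. length xs = m \<and> (\<forall>x \<in> set xs. P x) \<and> P x)" if "P x" for x
    using Suc that by simp
  then show ?case
    using ultra_mono[OF assms] by (simp add: conj_ac)
qed simp

section \<open>The semigroup of words\<close>

type_synonym word = "(nat \<times> (nat \<Rightarrow> nat)) list \<times> nat"

text \<open>A word is a list of pairs of a branch label and a step function, together with a total height.\<close>

definition step_fun :: "(nat \<Rightarrow> nat) \<Rightarrow> bool" where
  "step_fun q \<longleftrightarrow> q 0 = 0 \<and> (\<forall>t. q t \<le> q (Suc t) \<and> q (Suc t) \<le> Suc (q t))"

text \<open>Truncated subtraction keeps the legs of \<open>y\<close> at the root for the first
  \<open>snd x\<close> levels. The legs of \<open>x\<close> need no extension, since their functions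
  are defined on all heights.\<close>

definition word_cat :: "word \<Rightarrow> word \<Rightarrow> word" where
  "word_cat x y = (fst x @ map (\<lambda>(a, q). (a, \<lambda>t. q (t - snd x))) (fst y), snd x + snd y)"

text \<open>Forgetting the old label lets one ultrafilter per height serve every branch of
  \<open>A\<close>.\<close>

definition word_act :: "nat \<Rightarrow> (nat \<Rightarrow> nat) \<Rightarrow> word \<Rightarrow> word" where
  "word_act a p x = (map (\<lambda>(b, q). (a, p \<circ> q)) (fst x), snd x)"

text \<open>Asking for the value \<open>j\<close> already at \<open>snd x\<close> makes
  \<open>snd x\<close> a height that suffices for a fan on which the word is to reach
  \<open>j\<close>.\<close>

definition good_word :: "nat \<Rightarrow> word \<Rightarrow> bool" where
  "good_word j x \<longleftrightarrow> (\<forall>(b, q) \<in> set (fst x). step_fun q \<and> (\<forall>t. q t \<le> j)) \<and>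
     (\<exists>(b, q) \<in> set (fst x). q (snd x) = j)"

lemma word_cat_assoc: "word_cat (word_cat x y) z = word_cat x (word_cat y z)"
  by (simp add: word_cat_def case_prod_unfold)

lemma word_act_cat: "word_act a p (word_cat x y) = word_cat (word_act a p x) (word_act a p y)"
  by (simp add: word_cat_def word_act_def case_prod_unfold comp_def)

lemma word_act_act: "word_act a p (word_act b q x) = word_act a (p \<circ> q) x"
  by (simp add: word_act_def case_prod_unfold comp_def)

lemma step_fun_shift:
  assumes "step_fun q"
  shows "step_fun (\<lambda>t. q (t - h))"
proof -
  have "Suc t - h = Suc (t - h) \<or> Suc t - h = t - h" for t by arith
  then show ?thesis using assms unfolding step_fun_def by (metis diff_0_eq_0 le_SucI order_refl)
qed

lemma step_fun_mono: "step_fun q \<Longrightarrow> s \<le> t \<Longrightarrow> q s \<le> q t"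
  by (rule lift_Suc_mono_le[of q]) (auto simp: step_fun_def)

lemma good_word_cat:
  assumes "good_word i x" "good_word j y"
  shows "good_word (max i j) (word_cat x y)"
proof -
  have "step_fun q \<and> (\<forall>t. q t \<le> max i j)" if "(b, q) \<in> set (fst (word_cat x y))" for b q
    using that assms
    by (fastforce simp: word_cat_def good_word_def le_max_iff_disj intro: step_fun_shift)
  moreover have "\<exists>(b, q) \<in> set (fst (word_cat x y)). q (snd (word_cat x y)) = max i j"
  proof (cases "i \<le> j")
    case True
    obtain b q where "(b, q) \<in> set (fst y)" "q (snd y) = j"
      using assms(2) by (auto simp: good_word_def)
    then show ?thesis using True
      by (intro bexI[of _ "(b, \<lambda>t. q (t - snd x))"]) (auto simp: word_cat_def)
  next
    case False
    obtain b q where q: "(b, q) \<in> set (fst x)" "q (snd x) = i"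
      using assms(1) by (auto simp: good_word_def)
    then have "step_fun q" "q (snd x + snd y) \<le> i" using assms(1) by (auto simp: good_word_def)
    then have "q (snd x + snd y) = i" using step_fun_mono[of q "snd x" "snd x + snd y"] q by auto
    then show ?thesis using False q
      by (intro bexI[of _ "(b, q)"]) (auto simp: word_cat_def)
  qed
  ultimately show ?thesis by (auto simp: good_word_def)
qed

text \<open>The convolution is continuous in its left argument only, hence the asymmetric construction of
  the absorbing sequence below.\<close>

definition conv :: "((word \<Rightarrow> bool) \<Rightarrow> bool) \<Rightarrow> ((word \<Rightarrow> bool) \<Rightarrow> bool) \<Rightarrow> (word \<Rightarrow> bool) \<Rightarrow> bool" where
  "conv u v P = u (\<lambda>x. v (\<lambda>y. P (word_cat x y)))"

lemma conv_assoc: "conv (conv u v) w = conv u (conv v w)"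
  by (simp add: conv_def fun_eq_iff word_cat_assoc)

lemma ultra_conv: "ultra u \<Longrightarrow> ultra v \<Longrightarrow> ultra (conv u v)"
  by (simp add: ultra_def conv_def)

lemma push_act_conv: "push (word_act a p) (conv u v) = conv (push (word_act a p) u) (push (word_act a p) v)"
  by (simp add: push_def conv_def word_act_cat fun_eq_iff)

lemma conv_good:
  assumes "ultra u" "ultra v" "u (good_word i)" "v (good_word j)"
  shows "conv u v (good_word (max i j))"
proof -
  have "v (\<lambda>y. good_word (max i j) (word_cat x y))" if "good_word i x" for x
    using assms(2,4) by (rule ultra_mono) (simp add: good_word_cat that)
  then show ?thesis
    unfolding conv_def by (rule ultra_mono[OF assms(1,3)])
qed

text \<open>The coordinate of \<open>conv u v\<close> at \<open>P\<close> is the coordinate of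
  \<open>u\<close> at a predicate determined by \<open>v\<close> and \<open>P\<close>.\<close>

lemma continuous_conv: "continuous_on UNIV (\<lambda>u. conv u v)"
  unfolding conv_def
  by (intro continuous_on_coordinatewise_then_product continuous_on_product_coordinates)

text \<open>A sequence is one point of a compact space, so a single idempotent serves all heights
  and respects all step functions. The case where \<open>p\<close> is the identity says that
  \<open>u j\<close> does not see labels.\<close>

definition coherent :: "(nat \<Rightarrow> (word \<Rightarrow> bool) \<Rightarrow> bool) set" where
  "coherent = {u. (\<forall>j. ultra (u j)) \<and> (\<forall>j. u j (good_word j)) \<and>
     (\<forall>j p. step_fun p \<longrightarrow> push (word_act 0 p) (u j) = u (p j))}"

lemma closed_coherent: "closed coherent"
proof -
  have "closed {u :: nat \<Rightarrow> (word \<Rightarrow> bool) \<Rightarrow> bool. ultra (u j)}" for j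
  proof -
    have "closed ((\<lambda>u :: nat \<Rightarrow> (word \<Rightarrow> bool) \<Rightarrow> bool. u j) -` {u. ultra u})"
      by (rule closed_vimage[OF closed_ultra continuous_on_product_coordinates])
    then show ?thesis by (simp add: vimage_def)
  qed
  moreover have "closed {u :: nat \<Rightarrow> (word \<Rightarrow> bool) \<Rightarrow> bool. u j (good_word j)}" for j
  proof -
    have "closed {u :: nat \<Rightarrow> (word \<Rightarrow> bool) \<Rightarrow> bool. u j (good_word j) = True}"
      by (intro closed_Collect_eq continuous_on_const
          continuous_on_product_then_coordinatewise[OF continuous_on_product_coordinates])
    then show ?thesis by simp
  qed
  moreover have "closed {u. push (word_act 0 p) (u j) = u (p j)}" for j p
    unfolding push_def
    by (rule closed_Collect_eq)
      (intro continuous_on_coordinatewise_then_product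
        continuous_on_product_then_coordinatewise[OF continuous_on_product_coordinates],
        rule continuous_on_product_coordinates)
  ultimately show ?thesis
    unfolding coherent_def
    by (intro closed_Collect_conj closed_Collect_all) (auto intro: closed_Collect_imp)
qed


subsection \<open>Coherent sequences of ultrafilters\<close>

text \<open>On an increasing list this counts the entries up to \<open>t\<close>: the entries are
  the absolute positions of the jumps.\<close>

primrec jump_fun :: "nat list \<Rightarrow> nat \<Rightarrow> nat" where
  "jump_fun [] t = 0"
| "jump_fun (h # hs) t = (if t < h then 0 else Suc (jump_fun hs t))"

text \<open>A generic first position lies beyond \<open>m\<close>, so no jump has occurred by
  then.\<close>

lemma iter_lim_jump_fun_zero:
  assumes F: "ultra F" "\<And>m. F (\<lambda>n. m \<le> n)"
  shows "iter_lim F j (\<lambda>hs. \<forall>t \<le> m. jump_fun hs t = 0)"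
proof (cases j)
  case (Suc i)
  have "F (\<lambda>h. iter_lim F i (\<lambda>hs. \<forall>t \<le> m. jump_fun (h # hs) t = 0))"
  proof (rule ultra_mono[OF F(1), OF F(2)[of "Suc m"]])
    fix h assume "Suc m \<le> h"
    then have "(\<lambda>hs. \<forall>t \<le> m. jump_fun (h # hs) t = 0) = (\<lambda>_. True)" by auto
    then show "iter_lim F i (\<lambda>hs. \<forall>t \<le> m. jump_fun (h # hs) t = 0)"
      using ultra_const[OF ultra_iter_lim[OF F(1)]] by metis
  qed
  then show ?thesis using Suc by simp
qed simp

text \<open>The first position is positive, so the function starts at 0; the later ones lie beyond
  it, so the value never rises by more than one at a time.\<close>

lemma iter_lim_jump_fun_step:
  assumes F: "ultra F" "\<And>m. F (\<lambda>n. m \<le> n)"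
  shows "iter_lim F j (\<lambda>hs. step_fun (jump_fun hs) \<and> (\<forall>t. jump_fun hs t \<le> j) \<and>
    (\<exists>T0. \<forall>T \<ge> T0. jump_fun hs T = j))" (is "iter_lim F j (?Q j)")
proof (induction j)
  case 0
  then show ?case by (simp add: step_fun_def)
next
  case (Suc j)
  have "F (\<lambda>h. iter_lim F j (\<lambda>hs. ?Q (Suc j) (h # hs)))"
  proof (rule ultra_mono[OF F(1), OF F(2)[of 1]])
    fix h :: nat assume h: "1 \<le> h"
    have hs: "iter_lim F j (\<lambda>hs. ?Q j hs \<and> (\<forall>t \<le> h. jump_fun hs t = 0))"
      by (rule ultra_conjI[OF ultra_iter_lim[OF F(1)], OF Suc, OF iter_lim_jump_fun_zero[OF F]])
    show "iter_lim F j (\<lambda>hs. ?Q (Suc j) (h # hs))"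
    proof (rule ultra_mono[OF ultra_iter_lim[OF F(1)], OF hs])
      fix hs assume hs: "?Q j hs \<and> (\<forall>t \<le> h. jump_fun hs t = 0)"
      then obtain T0 where "\<forall>T \<ge> T0. jump_fun hs T = j" by auto
      then have "\<forall>T \<ge> max T0 h. jump_fun (h # hs) T = Suc j" by auto
      moreover have "step_fun (jump_fun (h # hs))"
        using hs h by (auto simp: step_fun_def)
      ultimately show "?Q (Suc j) (h # hs)" using hs by (auto simp del: max.bounded_iff jump_fun.simps(2)) auto
    qed
  qed
  then show ?case by (simp only: iter_lim.simps)
qed

text \<open>Composing with \<open>p\<close> erases the jumps at which \<open>p\<close> does not
  increase. The erased positions are dummy variables of the iterated limit, so a generic function
  with \<open>p j\<close> jumps remains.\<close>

lemma iter_lim_jump_fun_comp: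
  assumes F: "ultra F" "\<And>m. F (\<lambda>n. m \<le> n)" and "step_fun p"
  shows "iter_lim F j (\<lambda>hs. P (p \<circ> jump_fun hs)) = iter_lim F (p j) (\<lambda>hs. P (jump_fun hs))"
  using assms(3)
proof (induction j arbitrary: p P)
  case 0
  then have "p \<circ> jump_fun [] = jump_fun []" by (auto simp: step_fun_def fun_eq_iff)
  with 0 show ?case by (simp only: iter_lim.simps step_fun_def)
next
  case (Suc j)
  have p: "p 0 = 0" "\<And>t. p t \<le> p (Suc t)" "\<And>t. p (Suc t) \<le> Suc (p t)"
    using Suc.prems by (auto simp: step_fun_def)
  \<comment> \<open>This is \<open>p\<close> after its first step, rebased to start at 0;
    \<open>p (Suc 0)\<close> decides whether the first jump survives.\<close>
  define p' where "p' t = p (Suc t) - p (Suc 0)" for t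
  have p1: "p (Suc 0) = 0 \<or> p (Suc 0) = Suc 0" using p(3)[of 0] p(1) by auto
  have pS: "p (Suc t) = p (Suc 0) + p' t" for t
    using step_fun_mono[OF Suc.prems, of "Suc 0" "Suc t"] by (simp add: p'_def)
  have p': "step_fun p'"
  proof -
    have "p' t \<le> p' (Suc t)" "p' (Suc t) \<le> Suc (p' t)" for t
      using p(2)[of "Suc t"] p(3)[of "Suc t"] pS[of t] pS[of "Suc t"] by linarith+
    then show ?thesis by (simp add: step_fun_def) (simp add: p'_def)
  qed
  show ?case
  proof (cases "p (Suc 0) = 0")
    case True
    then have p'_eq: "p (Suc t) = p' t" for t using pS[of t] by simp
    have "iter_lim F j (\<lambda>hs. P (p \<circ> jump_fun (h # hs))) = iter_lim F (p (Suc j)) (\<lambda>hs. P (jump_fun hs))" for h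
    proof -
      \<comment> \<open>The two compositions can differ below \<open>h\<close> only if
        \<open>hs\<close> has a jump there, which almost never happens.\<close>
      have "iter_lim F j (\<lambda>hs. P (p \<circ> jump_fun (h # hs))) = iter_lim F j (\<lambda>hs. P (p' \<circ> jump_fun hs))"
      proof (rule ultra_cong[OF ultra_iter_lim[OF F(1)], OF iter_lim_jump_fun_zero[OF F, of j h]])
        fix hs assume hs: "\<forall>t \<le> h. jump_fun hs t = 0"
        have "p \<circ> jump_fun (h # hs) = p' \<circ> jump_fun hs"
          using hs p(1) p' by (auto simp: fun_eq_iff p'_eq step_fun_def)
        then show "P (p \<circ> jump_fun (h # hs)) = P (p' \<circ> jump_fun hs)" by simp
      qed
      then show ?thesis using Suc.IH[OF p', of P] by (simp only: p'_eq)
    qed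
    then show ?thesis by (simp only: iter_lim.simps ultra_const[OF F(1)])
  next
    case False
    then have S: "p (Suc t) = Suc (p' t)" for t using p1 pS[of t] by linarith
    have eq: "p \<circ> jump_fun (h # hs) = (\<lambda>t. if t < h then 0 else Suc ((p' \<circ> jump_fun hs) t))" for h hs
      using p(1) S by (auto simp: fun_eq_iff)
    have "iter_lim F j (\<lambda>hs. P (p \<circ> jump_fun (h # hs))) = iter_lim F (p' j) (\<lambda>hs. P (jump_fun (h # hs)))" for h
    proof -
      have eq': "jump_fun (h # hs) = (\<lambda>t. if t < h then 0 else Suc (jump_fun hs t))" for hs
        by (simp add: fun_eq_iff)
      show ?thesis
        unfolding eq unfolding eq' by (rule Suc.IH[OF p', of "\<lambda>q. P (\<lambda>t. if t < h then 0 else Suc (q t))"])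
    qed
    then show ?thesis by (simp only: iter_lim.simps S)
  qed
qed

text \<open>The witness is one leg labelled 0 with generic jump positions. The total height
  \<open>T\<close> is chosen last, so that all \<open>j\<close> jumps have occurred by then.\<close>

lemma coherent_nonempty: "coherent \<noteq> {}"
proof -
  obtain F :: "(nat \<Rightarrow> bool) \<Rightarrow> bool" where F: "ultra F" "\<And>m. F (\<lambda>n. m \<le> n)"
    using free_ultrafilter_ex by blast
  define L where "L j P = iter_lim F j (\<lambda>hs. F (\<lambda>T. P ([(0, jump_fun hs)], T)))" for j and P :: "word \<Rightarrow> bool"
  have "ultra (L j)" for j
    using F(1) ultra_iter_lim[OF F(1), of j] by (simp add: ultra_def L_def)
  moreover have "L j (good_word j)" for j
    unfolding L_def
  proof (rule ultra_mono[OF ultra_iter_lim[OF F(1)], OF iter_lim_jump_fun_step[OF F, of j]])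
    fix hs
    assume hs: "step_fun (jump_fun hs) \<and> (\<forall>t. jump_fun hs t \<le> j) \<and> (\<exists>T0. \<forall>T \<ge> T0. jump_fun hs T = j)"
    then obtain T0 where "\<forall>T \<ge> T0. jump_fun hs T = j" by auto
    then show "F (\<lambda>T. good_word j ([(0, jump_fun hs)], T))"
      using hs by (intro ultra_mono[OF F(1), OF F(2)[of T0]]) (auto simp: good_word_def)
  qed
  moreover have "push (word_act 0 p) (L j) = L (p j)" if "step_fun p" for j p
  proof
    fix P
    show "push (word_act 0 p) (L j) P = L (p j) P"
      using iter_lim_jump_fun_comp[OF F that, of j "\<lambda>q. F (\<lambda>T. P ([(0, q)], T))"]
      by (simp add: push_def L_def word_act_def)
  qed
  ultimately have "L \<in> coherent" by (simp add: coherent_def)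
  then show ?thesis by auto
qed

lemma coherentD:
  assumes "u \<in> coherent"
  shows "ultra (u j)" "u j (good_word j)" "step_fun p \<Longrightarrow> push (word_act 0 p) (u j) = u (p j)"
  using assms by (auto simp: coherent_def)

lemma coherent_conv:
  assumes "u \<in> coherent" "v \<in> coherent"
  shows "(\<lambda>j. conv (u j) (v j)) \<in> coherent"
proof -
  have "conv (u j) (v j) (good_word j)" for j
    using conv_good[of "u j" "v j" j j] coherentD[OF assms(1)] coherentD[OF assms(2)] by simp
  then show ?thesis
    by (auto simp: coherent_def push_act_conv coherentD[OF assms(1)] coherentD[OF assms(2)]
        intro: ultra_conv)
qed

lemma coherent_idempotent:
  assumes "closed Z" "Z \<noteq> {}" "Z \<subseteq> coherent"
    and "\<And>u v. u \<in> Z \<Longrightarrow> v \<in> Z \<Longrightarrow> (\<lambda>j. conv (u j) (v j)) \<in> Z"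
  shows "\<exists>u \<in> Z. \<forall>j. conv (u j) (u j) = u j"
proof -
  have "compact (UNIV :: (nat \<Rightarrow> (word \<Rightarrow> bool) \<Rightarrow> bool) set)"
    by (intro compact_UNIV_fun compact_UNIV_bool)
  then have "compact Z" using assms(1) compact_Int_closed by fastforce
  moreover have "continuous_on UNIV (\<lambda>u :: nat \<Rightarrow> (word \<Rightarrow> bool) \<Rightarrow> bool. \<lambda>j. conv (u j) (v j))" for v
    by (intro continuous_on_coordinatewise_then_product
        continuous_on_compose2[OF continuous_conv continuous_on_product_coordinates]) simp
  ultimately have "\<exists>u \<in> Z. (\<lambda>j. conv (u j) (u j)) = u"
    using assms(2,4) by (intro Ellis_idempotent[where f = "\<lambda>u v j. conv (u j) (v j)"])
      (auto simp: conv_assoc)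
  then show ?thesis by (auto dest: fun_cong)
qed

section \<open>Ordered products of idempotents and two-sided absorption\<close>

primrec desc :: "(nat \<Rightarrow> (word \<Rightarrow> bool) \<Rightarrow> bool) \<Rightarrow> nat \<Rightarrow> (word \<Rightarrow> bool) \<Rightarrow> bool" where
  "desc u 0 = u 0"
| "desc u (Suc j) = conv (u (Suc j)) (desc u j)"

primrec asc :: "(nat \<Rightarrow> (word \<Rightarrow> bool) \<Rightarrow> bool) \<Rightarrow> nat \<Rightarrow> (word \<Rightarrow> bool) \<Rightarrow> bool" where
  "asc u 0 = u 0"
| "asc u (Suc j) = conv (asc u j) (u (Suc j))"

lemma step_fun_Suc_cases: "step_fun p \<Longrightarrow> p (Suc j) = p j \<or> p (Suc j) = Suc (p j)"
proof -
  assume "step_fun p"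
  then have "p j \<le> p (Suc j)" "p (Suc j) \<le> Suc (p j)" by (auto simp: step_fun_def)
  then show ?thesis by linarith
qed

text \<open>A step function \<open>p\<close> turns the factors \<open>u j, ..., u 0\<close> into
  \<open>u (p j), ..., u (p 0)\<close>. Consecutive heights are equal or differ by one, so
  repetitions merge by idempotence and \<open>desc u (p j)\<close> remains.\<close>

lemma desc_coherent:
  assumes u: "u \<in> coherent" and idem: "\<And>j. conv (u j) (u j) = u j"
  shows "desc u \<in> coherent"
proof -
  have "ultra (desc u j)" for j
    by (induction j) (auto simp: coherentD[OF u] intro: ultra_conv)
  moreover have "desc u j (good_word j)" for j
  proof (induction j)
    case (Suc j)
    have "conv (u (Suc j)) (desc u j) (good_word (max (Suc j) j))"
      by (rule conv_good) (use Suc calculation coherentD[OF u] in auto)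
    then show ?case by simp
  qed (simp add: coherentD[OF u])
  moreover have "conv (u m) (desc u m) = desc u m" for m
    by (cases m) (simp_all add: idem conv_assoc[symmetric])
  then have "push (word_act 0 p) (desc u j) = desc u (p j)" if p: "step_fun p" for p j
  proof (induction j)
    case 0
    then show ?case using p coherentD(3)[OF u p, of 0] by (simp add: step_fun_def)
  next
    case (Suc j)
    then show ?case
      using step_fun_Suc_cases[OF p, of j] by (auto simp: push_act_conv coherentD(3)[OF u p])
  qed
  ultimately show ?thesis by (simp add: coherent_def)
qed

lemma asc_coherent:
  assumes u: "u \<in> coherent" and idem: "\<And>j. conv (u j) (u j) = u j"
  shows "asc u \<in> coherent"
proof -
  have "ultra (asc u j)" for j
    by (induction j) (auto simp: coherentD[OF u] intro: ultra_conv)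
  moreover have "asc u j (good_word j)" for j
  proof (induction j)
    case (Suc j)
    have "conv (asc u j) (u (Suc j)) (good_word (max j (Suc j)))"
      by (rule conv_good) (use Suc calculation coherentD[OF u] in auto)
    then show ?case by simp
  qed (simp add: coherentD[OF u])
  moreover have "conv (asc u m) (u m) = asc u m" for m
    by (cases m) (simp_all add: idem conv_assoc)
  then have "push (word_act 0 p) (asc u j) = asc u (p j)" if p: "step_fun p" for p j
  proof (induction j)
    case 0
    then show ?case using p coherentD(3)[OF u p, of 0] by (simp add: step_fun_def)
  next
    case (Suc j)
    then show ?case
      using step_fun_Suc_cases[OF p, of j] by (auto simp: push_act_conv coherentD(3)[OF u p])
  qed
  ultimately show ?thesis by (simp add: coherent_def)
qed

lemma coherent_right_absorbing:
  "\<exists>u \<in> coherent. (\<forall>j. conv (u j) (u j) = u j) \<and> (\<forall>j \<le> K. \<forall>a \<le> j. conv (u j) (u a) = u j)"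
proof (induction K)
  case 0
  show ?case
  proof -
    obtain u where "u \<in> coherent" "\<And>j. conv (u j) (u j) = u j"
      using coherent_idempotent[OF closed_coherent coherent_nonempty order_refl coherent_conv] by blast
    then show ?thesis by (intro bexI[of _ u]) auto
  qed
next
  case (Suc i)
  then obtain u where u: "u \<in> coherent" and idem: "\<And>j. conv (u j) (u j) = u j"
    and absorb: "\<And>j a. j \<le> i \<Longrightarrow> a \<le> j \<Longrightarrow> conv (u j) (u a) = u j"
    by blast
  \<comment> \<open>\<open>desc u\<close> belongs to \<open>Z\<close>: it agrees with
    \<open>u\<close> up to \<open>i\<close>, and its term at \<open>Suc i\<close> ends in the factor
    \<open>u i\<close>, which absorbs. Associativity makes \<open>Z\<close> a subsemigroup.\<close>
  define Z where "Z = {z \<in> coherent. (\<forall>j \<le> i. z j = u j) \<and> (\<forall>a \<le> i. conv (z (Suc i)) (u a) = z (Suc i))}"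
  have desc_eq: "desc u j = u j" if "j \<le> i" for j
    using that by (induction j) (auto simp: absorb)
  then have ne: "desc u \<in> Z"
    using desc_coherent[OF u idem] by (auto simp: Z_def conv_assoc absorb)
  have closed: "closed Z"
  proof -
    have c: "continuous_on UNIV (\<lambda>z :: nat \<Rightarrow> (word \<Rightarrow> bool) \<Rightarrow> bool. conv (z j) v)" for j v
      by (rule continuous_on_compose2[OF continuous_conv continuous_on_product_coordinates]) simp
    have "closed {z :: nat \<Rightarrow> (word \<Rightarrow> bool) \<Rightarrow> bool. z j = u j}" for j
      by (rule closed_Collect_eq[OF continuous_on_product_coordinates continuous_on_const])
    moreover have "closed {z :: nat \<Rightarrow> (word \<Rightarrow> bool) \<Rightarrow> bool. conv (z (Suc i)) (u a) = z (Suc i)}" for a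
      by (rule closed_Collect_eq[OF c continuous_on_product_coordinates])
    ultimately show ?thesis
      unfolding Z_def using closed_coherent
      by (intro closed_Collect_conj closed_Collect_all) (auto intro!: closed_Collect_imp)
  qed
  have mult: "(\<lambda>j. conv (z j) (z' j)) \<in> Z" if "z \<in> Z" "z' \<in> Z" for z z'
    using that coherent_conv[of z z'] by (auto simp: Z_def idem conv_assoc)
  have "Z \<subseteq> coherent" "Z \<noteq> {}" using ne by (auto simp: Z_def)
  then obtain z where z: "z \<in> Z" "\<And>j. conv (z j) (z j) = z j"
    using coherent_idempotent[OF closed _ _ mult] by blast
  have "conv (z j) (z a) = z j" if "j \<le> Suc i" "a \<le> j" for j a
  proof (cases "a \<le> i")
    case True
    then show ?thesis using that z absorb by (cases "j = Suc i") (auto simp: Z_def)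
  next
    case False
    then have "a = j" using that by auto
    then show ?thesis using z by simp
  qed
  then show ?case using z by (auto simp: Z_def)
qed

text \<open>The last factor \<open>u j\<close> of \<open>asc u j\<close> absorbs lower terms on the
  right. On the left, for \<open>a <= j\<close>, the product \<open>asc u a\<close> is idempotent
  and an initial factor of \<open>asc u j\<close>, so it is absorbed there as well.\<close>

proposition absorbing_coherent:
  "\<exists>w \<in> coherent. \<forall>i \<le> K. \<forall>j \<le> K. conv (w i) (w j) = w (max i j)"
proof -
  obtain u where u: "u \<in> coherent" and idem: "\<And>j. conv (u j) (u j) = u j"
    and absorb: "\<And>j a. j \<le> K \<Longrightarrow> a \<le> j \<Longrightarrow> conv (u j) (u a) = u j"
    using coherent_right_absorbing[of K] by blast
  have au: "conv (asc u j) (u a) = asc u j" if "j \<le> K" "a \<le> j" for j a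
    using that by (cases j) (simp_all add: absorb conv_assoc)
  have ge: "conv (asc u j) (asc u a) = asc u j" if "j \<le> K" "a \<le> j" for j a
    using that(2) by (induction a) (simp_all add: au that(1) conv_assoc[symmetric])
  have le: "conv (asc u a) (asc u j) = asc u j" if "j \<le> K" "a \<le> j" for j a
    using that(2,1) by (induction j rule: dec_induct) (simp_all add: ge conv_assoc[symmetric])
  have "conv (asc u i) (asc u j) = asc u (max i j)" if "i \<le> K" "j \<le> K" for i j
    using that ge le by (cases "i \<le> j") (auto simp: max_def)
  then show ?thesis using asc_coherent[OF u idem] by blast
qed

section \<open>Words with labelled legs\<close>

primrec word_prod :: "word list \<Rightarrow> word" where
  "word_prod [] = ([], 0)"
| "word_prod (x # xs) = word_cat x (word_prod xs)"

primrec conv_prod :: "((word \<Rightarrow> bool) \<Rightarrow> bool) list \<Rightarrow> (word \<Rightarrow> bool) \<Rightarrow> bool" where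
  "conv_prod [] = (\<lambda>P. P ([], 0))"
| "conv_prod (u # us) = conv u (conv_prod us)"

lemma ultra_conv_prod: "\<forall>u \<in> set us. ultra u \<Longrightarrow> ultra (conv_prod us)"
  by (induction us) (auto simp: ultra_principal ultra_conv)

text \<open>Letter \<open>b\<close> records what an epimorphism does to the \<open>b\<close>-th
  branch of \<open>B\<close>; inserting it into the \<open>b\<close>-th block is composition with
  the map that the blocks describe.\<close>

definition apply_letters :: "(nat \<times> (nat \<Rightarrow> nat)) list \<Rightarrow> word list \<Rightarrow> word" where
  "apply_letters \<sigma> xs = word_prod (map2 (\<lambda>s x. word_act (fst s) (snd s) x) \<sigma> xs)"

text \<open>Both sides nest their quantifiers alike, with the first block outermost.\<close>

lemma iter_lim_apply_letters:
  "iter_lim u (length \<sigma>) (\<lambda>xs. P (apply_letters \<sigma> xs)) =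
     conv_prod (map (\<lambda>s. push (word_act (fst s) (snd s)) u) \<sigma>) P"
proof (induction \<sigma> arbitrary: P)
  case Nil
  then show ?case by (simp add: apply_letters_def)
next
  case (Cons s \<sigma>)
  have "iter_lim u (length (s # \<sigma>)) (\<lambda>xs. P (apply_letters (s # \<sigma>) xs)) =
    u (\<lambda>x. iter_lim u (length \<sigma>) (\<lambda>xs. P (word_cat (word_act (fst s) (snd s) x) (apply_letters \<sigma> xs))))"
    by (simp add: apply_letters_def)
  also have "\<dots> = u (\<lambda>x. conv_prod (map (\<lambda>s. push (word_act (fst s) (snd s)) u) \<sigma>)
      (\<lambda>y. P (word_cat (word_act (fst s) (snd s) x) y)))"
    by (simp only: Cons.IH[of "\<lambda>y. P (word_cat z y)" for z])
  also have "\<dots> = conv (push (word_act (fst s) (snd s)) u)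
      (conv_prod (map (\<lambda>s. push (word_act (fst s) (snd s)) u) \<sigma>)) P"
    by (simp only: conv_def push_def)
  finally show ?case by simp
qed

text \<open>\<open>t\<close> is the height already reached in the branch \<open>a\<close>.\<close>

lemma conv_prod_collapse:
  fixes k :: nat
  assumes W: "\<And>a i j. i \<le> k \<Longrightarrow> j \<le> k \<Longrightarrow> conv (W a i) (W a j) = W a (max i j)"
    and "sorted (map fst l)" "\<forall>(b, j) \<in> set l. a \<le> b \<and> b < n \<and> j \<le> k"
    and "\<forall>b. a < b \<and> b < n \<longrightarrow> (b, k) \<in> set l" "t \<le> k" "t = k \<or> (a, k) \<in> set l" "a < n"
  shows "conv (W a t) (conv_prod (map (\<lambda>(b, j). W b j) l)) = conv_prod (map (\<lambda>b. W b k) [a..<n])"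
  using assms(2-)
proof (induction l arbitrary: a t)
  case Nil
  then have "Suc a = n" by (metis Suc_lessI empty_iff empty_set lessI)
  then have "[a..<n] = [a]" by auto
  with Nil show ?case by simp
next
  case (Cons s l)
  obtain b j where s: "s = (b, j)" by fastforce
  have b: "a \<le> b" "b < n" "j \<le> k" using Cons.prems(2) by (auto simp: s)
  have lb: "b \<le> b'" if "(b', j') \<in> set l" for b' j'
    using Cons.prems(1) that by (force simp: s)
  show ?case
  \<comment> \<open>\<open>W a t\<close> is the pending factor. A next factor on the same branch is
    absorbed, leaving the larger height. When the labels leave \<open>a\<close>, the pair
    \<open>(a, k)\<close> can no longer occur, so \<open>t\<close> is already \<open>k\<close>; as
    no branch is missed, the next label is \<open>Suc a\<close>.\<close>
  proof (cases "b = a")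
    case True
    have "conv (W a t) (conv_prod (map (\<lambda>(b, j). W b j) (s # l))) =
        conv (W a (max t j)) (conv_prod (map (\<lambda>(b, j). W b j) l))"
      using b Cons.prems(4) by (simp add: s True W conv_assoc[symmetric])
    also have "\<dots> = conv_prod (map (\<lambda>b. W b k) [a..<n])"
    proof (rule Cons.IH)
      show "max t j = k \<or> (a, k) \<in> set l"
      proof -
        have "t = k \<or> j = k \<or> (a, k) \<in> set l" using Cons.prems(5) by (auto simp: s True)
        then show ?thesis
          using b Cons.prems(4) by (elim disjE) (simp_all add: max_absorb1 max_absorb2)
      qed
    qed (use Cons.prems b in \<open>auto simp: s True\<close>)
    finally show ?thesis .
  next
    case False
    then have ab: "a < b" using b by auto
    have "t = k" using Cons.prems(5) lb[of a k] ab by (metis Pair_inject not_less s set_ConsD less_irrefl)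
    have "b = Suc a"
    proof (rule ccontr)
      assume "b \<noteq> Suc a"
      then have "Suc a < b" using ab by auto
      then have "(Suc a, k) \<in> set l" using Cons.prems(3) b by (auto simp: s)
      then show False using lb[of "Suc a" k] \<open>Suc a < b\<close> by auto
    qed
    have "conv (W b j) (conv_prod (map (\<lambda>(b, j). W b j) l)) = conv_prod (map (\<lambda>b. W b k) [b..<n])"
    proof (rule Cons.IH)
      show "\<forall>b'. b < b' \<and> b' < n \<longrightarrow> (b', k) \<in> set l"
      proof (intro allI impI)
        fix b' assume "b < b' \<and> b' < n"
        then have "(b', k) \<in> set (s # l)" "b' \<noteq> b" using Cons.prems(3) ab by auto
        then show "(b', k) \<in> set l" by (simp add: s)
      qed
      show "j = k \<or> (b, k) \<in> set l"
        using Cons.prems(3)[rule_format, of b] ab b by (auto simp: s)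
    qed (use Cons.prems b lb in \<open>auto simp: s\<close>)
    moreover have "[a..<n] = a # [b..<n]" using \<open>b = Suc a\<close> b by (simp add: upt_conv_Cons)
    ultimately show ?thesis by (simp add: s \<open>t = k\<close>)
  qed
qed

section \<open>The Ramsey statement for words\<close>

text \<open>Sortedness comes from S, the step condition from R, and the last clause from
  surjectivity. Only heights up to \<open>K\<close> matter, and by monotonicity the bound at
  \<open>K\<close> covers them.\<close>

definition valid_letters :: "nat \<Rightarrow> nat \<Rightarrow> nat \<Rightarrow> (nat \<times> (nat \<Rightarrow> nat)) list \<Rightarrow> bool" where
  "valid_letters n k K \<sigma> \<longleftrightarrow> sorted (map fst \<sigma>) \<and>
     (\<forall>(a, p) \<in> set \<sigma>. a < n \<and> step_fun p \<and> p K \<le> k) \<and> (\<forall>a < n. \<exists>p. (a, p) \<in> set \<sigma> \<and> p K = k)"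

text \<open>Each word has a limit colour along the sizes \<open>N\<close>, and \<gamma> is the limit
  of these along \<Omega>. Every letter list in \<Sigma> turns \<open>w K\<close>-generic blocks
  into an \<Omega>-generic word and so meets \<gamma>. The size is chosen after the blocks, which is
  why \<open>bound\<close> may depend on \<open>xs\<close>.\<close>

proposition word_ramsey:
  fixes col :: "nat \<Rightarrow> word \<Rightarrow> nat" and bound :: "word list \<Rightarrow> nat"
  assumes "\<And>N y. col N y < r" "finite \<Sigma>" "1 \<le> n"
    and \<Sigma>: "\<And>\<sigma>. \<sigma> \<in> \<Sigma> \<Longrightarrow> length \<sigma> = m \<and> valid_letters n k K \<sigma>"
  shows "\<exists>xs N \<gamma>. length xs = m \<and> (\<forall>x \<in> set xs. good_word K x) \<and> bound xs \<le> N \<and>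
    (\<forall>\<sigma> \<in> \<Sigma>. col N (apply_letters \<sigma> xs) = \<gamma>)"
proof -
  obtain w where w: "w \<in> coherent"
    and absorb: "\<And>i j. i \<le> k \<Longrightarrow> j \<le> k \<Longrightarrow> conv (w i) (w j) = w (max i j)"
    using absorbing_coherent[of k] by blast
  obtain F :: "(nat \<Rightarrow> bool) \<Rightarrow> bool" where F: "ultra F" "\<And>m. F (\<lambda>n. m \<le> n)"
    using free_ultrafilter_ex by blast
  define W where "W a j = push (word_act a id) (w j)" for a j
  have W: "conv (W a i) (W a j) = W a (max i j)" if "i \<le> k" "j \<le> k" for a i j
    using absorb[OF that] by (simp add: W_def push_act_conv[symmetric])
  define \<Omega> where "\<Omega> = conv_prod (map (\<lambda>b. W b k) [0..<n])"
  have \<Omega>: "ultra \<Omega>"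
    unfolding \<Omega>_def by (rule ultra_conv_prod) (auto simp: W_def intro!: ultra_push coherentD[OF w])
  have "\<exists>c < r. F (\<lambda>N. col N y = c)" for y
    by (rule ultra_finite_colour[OF F(1)]) (simp add: assms(1) ultra_const[OF F(1)])
  then obtain f where f: "\<And>y. f y < r" "\<And>y. F (\<lambda>N. col N y = f y)"
    by metis
  obtain \<gamma> where "\<Omega> (\<lambda>y. f y = \<gamma>)"
    using ultra_finite_colour[OF \<Omega>, of f r] f(1) by (auto simp: ultra_const[OF \<Omega>])
  then have \<gamma>: "\<Omega> (\<lambda>y. F (\<lambda>N. col N y = \<gamma>))"
    by (rule ultra_mono[OF \<Omega>]) (use f(2) in auto)
  have "iter_lim (w K) m (\<lambda>xs. F (\<lambda>N. col N (apply_letters \<sigma> xs) = \<gamma>))" if "\<sigma> \<in> \<Sigma>" for \<sigma>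
  proof -
    have len: "length \<sigma> = m" and v: "valid_letters n k K \<sigma>" using \<Sigma>[OF that] by auto
    have "push (word_act (fst s) (snd s)) (w K) = W (fst s) (snd s K)" if "s \<in> set \<sigma>" for s
    proof -
      have "step_fun (snd s)" using v that by (auto simp: valid_letters_def)
      then have "w (snd s K) = push (word_act 0 (snd s)) (w K)"
        by (simp add: coherentD(3)[OF w])
      then show ?thesis
        by (simp add: W_def push_push comp_def word_act_act)
    qed
    then have eq: "map (\<lambda>s. push (word_act (fst s) (snd s)) (w K)) \<sigma> =
      map (\<lambda>(b, j). W b j) (map (\<lambda>s. (fst s, snd s K)) \<sigma>)"
      by simp
    have "conv_prod (map (\<lambda>(b, j). W b j) (map (\<lambda>s. (fst s, snd s K)) \<sigma>)) = \<Omega>"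
    proof (cases \<sigma>)
      case Nil
      then show ?thesis using v assms(3) by (auto simp: valid_letters_def)
    next
      case (Cons s \<sigma>')
      obtain p where "(0, p) \<in> set \<sigma>" using v assms(3) by (auto simp: valid_letters_def)
      then have "fst s = 0" using v by (force simp: valid_letters_def Cons)
      have full: "\<exists>p. (b, p) \<in> set \<sigma> \<and> p K = k" if "b < n" for b
        using v that by (simp add: valid_letters_def)
      have "conv (W 0 (snd s K)) (conv_prod (map (\<lambda>(b, j). W b j) (map (\<lambda>s. (fst s, snd s K)) \<sigma>'))) =
          conv_prod (map (\<lambda>b. W b k) [0..<n])"
      proof (rule conv_prod_collapse[OF W])
        show "\<forall>b. 0 < b \<and> b < n \<longrightarrow> (b, k) \<in> set (map (\<lambda>s. (fst s, snd s K)) \<sigma>')"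
          using full \<open>fst s = 0\<close> by (force simp: Cons)
        show "snd s K = k \<or> (0, k) \<in> set (map (\<lambda>s. (fst s, snd s K)) \<sigma>')"
          using full[of 0] assms(3) by (force simp: Cons)
      qed (use v assms(3) in \<open>auto simp: Cons valid_letters_def comp_def\<close>)
      then show ?thesis by (simp add: Cons \<Omega>_def \<open>fst s = 0\<close>)
    qed
    then have "conv_prod (map (\<lambda>s. push (word_act (fst s) (snd s)) (w K)) \<sigma>) = \<Omega>"
      by (simp only: eq)
    then show ?thesis
      using iter_lim_apply_letters[of "w K" \<sigma> "\<lambda>y. F (\<lambda>N. col N y = \<gamma>)"] \<gamma> len by simp
  qed
  then have "iter_lim (w K) m (\<lambda>xs. \<forall>\<sigma> \<in> \<Sigma>. F (\<lambda>N. col N (apply_letters \<sigma> xs) = \<gamma>))"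
    by (simp add: ultra_finite_ball[OF ultra_iter_lim[OF coherentD(1)[OF w]] assms(2)])
  from ultra_conjI[OF ultra_iter_lim[OF coherentD(1)[OF w]],
      OF iter_lim_all[OF coherentD(1)[OF w], OF coherentD(2)[OF w, of K]], OF this]
  obtain xs where xs: "length xs = m" "\<forall>x \<in> set xs. good_word K x"
    and "\<forall>\<sigma> \<in> \<Sigma>. F (\<lambda>N. col N (apply_letters \<sigma> xs) = \<gamma>)"
    using ultra_ex[OF ultra_iter_lim[OF coherentD(1)[OF w]]] by fast
  then have "F (\<lambda>N. \<forall>\<sigma> \<in> \<Sigma>. col N (apply_letters \<sigma> xs) = \<gamma>)"
    by (simp add: ultra_finite_ball[OF F(1) assms(2)])
  from ultra_ex[OF F(1), OF ultra_conjI[OF F(1), OF F(2)[of "bound xs"], OF this]]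
  show ?thesis using xs by blast
qed

text \<open>Composition with an epimorphism out of \<open>B\<close>: unlike in
  \<open>word_act\<close>, the letter applied to a leg depends on the label that the leg
  carries.\<close>

definition relabel :: "(nat \<Rightarrow> nat \<times> (nat \<Rightarrow> nat)) \<Rightarrow> word \<Rightarrow> word" where
  "relabel g x = (map (\<lambda>(b, q). (fst (g b), snd (g b) \<circ> q)) (fst x), snd x)"

text \<open>Block \<open>b\<close> lies over branch \<open>b\<close> of \<open>B\<close>, with its
  own step functions unchanged; this is the word of the map \<open>g\<close> onto
  \<open>B\<close>.\<close>

definition join_blocks :: "word list \<Rightarrow> word" where
  "join_blocks xs = apply_letters (map (\<lambda>b. (b, id)) [0..<length xs]) xs"

lemma relabel_word_prod: "relabel g (word_prod zs) = word_prod (map (relabel g) zs)"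
proof (induction zs)
  case (Cons z zs)
  have "relabel g (word_cat x y) = word_cat (relabel g x) (relabel g y)" for x y
    by (simp add: relabel_def word_cat_def case_prod_unfold comp_def)
  with Cons show ?case by simp
qed (simp add: relabel_def)

lemma relabel_join_blocks:
  assumes "length xs = length \<sigma>"
  shows "relabel (\<lambda>b. \<sigma> ! b) (join_blocks xs) = apply_letters \<sigma> xs"
proof -
  have "relabel g (word_act b id x) = word_act (fst (g b)) (snd (g b)) x" for g b x
    by (simp add: relabel_def word_act_def case_prod_unfold)
  then have "map (relabel (\<lambda>b. \<sigma> ! b)) (map2 (\<lambda>s x. word_act (fst s) (snd s) x) (map (\<lambda>b. (b, id)) [0..<length xs]) xs) =
    map2 (\<lambda>s x. word_act (fst s) (snd s) x) \<sigma> xs"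
    using assms by (intro nth_equalityI) simp_all
  then show ?thesis
    by (simp only: join_blocks_def apply_letters_def relabel_word_prod)
qed

text \<open>The bound is required at all heights, as the fan that carries the word may be taller
  than \<open>snd x\<close>.\<close>

definition valid_word :: "nat \<Rightarrow> nat \<Rightarrow> word \<Rightarrow> bool" where
  "valid_word n k x \<longleftrightarrow> sorted (map fst (fst x)) \<and>
     (\<forall>(a, q) \<in> set (fst x). a < n \<and> step_fun q \<and> (\<forall>t. q t \<le> k)) \<and>
     (\<forall>a < n. \<exists>q. (a, q) \<in> set (fst x) \<and> q (snd x) = k)"

lemma valid_join_blocks:
  assumes "\<forall>x \<in> set xs. good_word K x"
  shows "valid_word (length xs) K (join_blocks xs)"
proof -
  \<comment> \<open>Removing the first block shifts the labels, so the induction needs an arbitrary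
    starting label \<open>s\<close>.\<close>
  define J where "J s xs = apply_letters (map (\<lambda>b. (b, id)) [s..<s + length xs]) xs" for s xs
  have "sorted (map fst (fst (J s xs))) \<and>
    (\<forall>(a, q) \<in> set (fst (J s xs)). s \<le> a \<and> a < s + length xs \<and> step_fun q \<and> (\<forall>t. q t \<le> K)) \<and>
    (\<forall>a. s \<le> a \<and> a < s + length xs \<longrightarrow> (\<exists>q. (a, q) \<in> set (fst (J s xs)) \<and> q (snd (J s xs)) = K))"
    for s using assms
  proof (induction xs arbitrary: s)
    case Nil
    then show ?case by (simp add: J_def apply_letters_def)
  next
    case (Cons x xs)
    have x: "good_word K x" using Cons.prems by simp
    define y where "y = J (Suc s) xs"
    have IH: "sorted (map fst (fst y))"
      "\<And>a q. (a, q) \<in> set (fst y) \<Longrightarrow> Suc s \<le> a \<and> a < Suc s + length xs \<and> step_fun q \<and> (\<forall>t. q t \<le> K)"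
      "\<And>a. Suc s \<le> a \<Longrightarrow> a < Suc s + length xs \<Longrightarrow> \<exists>q. (a, q) \<in> set (fst y) \<and> q (snd y) = K"
      using Cons.IH[of "Suc s"] Cons.prems by (auto simp: y_def)
    have J: "J s (x # xs) = word_cat (word_act s id x) y"
      by (simp add: J_def apply_letters_def y_def upt_conv_Cons del: upt_Suc)
    have fstJ: "fst (J s (x # xs)) = map (\<lambda>(b, q). (s, q)) (fst x) @ map (\<lambda>(a, q). (a, \<lambda>t. q (t - snd x))) (fst y)"
      and sndJ: "snd (J s (x # xs)) = snd x + snd y"
      by (simp_all add: J word_cat_def word_act_def case_prod_unfold)
    have "sorted (map fst (fst (J s (x # xs))))"
      using IH(1,2) by (force simp: fstJ sorted_append comp_def case_prod_unfold sorted_map)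
    moreover have "s \<le> a \<and> a < s + length (x # xs) \<and> step_fun q \<and> (\<forall>t. q t \<le> K)"
      if "(a, q) \<in> set (fst (J s (x # xs)))" for a q
      using that x IH(2) by (fastforce simp: fstJ good_word_def intro: step_fun_shift)
    moreover have "\<exists>q. (a, q) \<in> set (fst (J s (x # xs))) \<and> q (snd (J s (x # xs))) = K"
      if a: "s \<le> a" "a < s + length (x # xs)" for a
    proof (cases "a = s")
      case True
      obtain b q where q: "(b, q) \<in> set (fst x)" "q (snd x) = K"
        using x by (auto simp: good_word_def)
      then have "step_fun q" "q (snd x + snd y) \<le> K" using x by (auto simp: good_word_def)
      then have "q (snd x + snd y) = K" using step_fun_mono[of q "snd x" "snd x + snd y"] q by auto
      then show ?thesis using q True by (intro exI[of _ q]) (force simp: fstJ sndJ)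
    next
      case False
      then obtain q where "(a, q) \<in> set (fst y)" "q (snd y) = K"
        using IH(3)[of a] a by fastforce
      then show ?thesis by (intro exI[of _ "\<lambda>t. q (t - snd x)"]) (force simp: fstJ sndJ)
    qed
    ultimately show ?case by blast
  qed
  from this[of 0] show ?thesis
    by (simp add: J_def join_blocks_def valid_word_def)
qed

section \<open>Coordinates on the structures and epimorphisms\<close>

text \<open>The vertex \<open>v i j\<close> lies on the \<open>i\<close>-th branch at distance \<open>j\<close> from the root; \<open>v i 0\<close> is the
  root for every \<open>i\<close>.\<close>

definition spider :: "nat \<Rightarrow> nat \<Rightarrow> (nat \<Rightarrow> nat \<Rightarrow> 'a) \<Rightarrow> 'a RS_structure \<Rightarrow> bool" where
  "spider n k v A \<longleftrightarrow> 1 \<le> n \<and> (k = 0 \<longrightarrow> n = 1) \<and>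
     (\<forall>i < n. \<forall>i' < n. \<forall>j \<le> k. \<forall>j' \<le> k. v i j = v i' j' \<longleftrightarrow> j = j' \<and> (j = 0 \<or> i = i')) \<and>
     points A = {v i j | i j. i < n \<and> j \<le> k} \<and>
     relR A = {(v i j, v i j') | i j j'. i < n \<and> j \<le> k \<and> j' \<le> k \<and> (j' = j \<or> j' = Suc j)} \<and>
     relS A = {(v i j, v i' j') | i i' j j'. i \<le> i' \<and> i' < n \<and> j \<le> k \<and> j' \<le> k}"

lemma spiderD:
  assumes "spider n k v A"
  shows "1 \<le> n" "k = 0 \<Longrightarrow> n = 1"
    and "\<And>i i' j j'. i < n \<Longrightarrow> i' < n \<Longrightarrow> j \<le> k \<Longrightarrow> j' \<le> k \<Longrightarrow>
      v i j = v i' j' \<longleftrightarrow> j = j' \<and> (j = 0 \<or> i = i')"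
    and "points A = {v i j | i j. i < n \<and> j \<le> k}"
    and "relR A = {(v i j, v i j') | i j j'. i < n \<and> j \<le> k \<and> j' \<le> k \<and> (j' = j \<or> j' = Suc j)}"
    and "relS A = {(v i j, v i' j') | i i' j j'. i \<le> i' \<and> i' < n \<and> j \<le> k \<and> j' \<le> k}"
  using assms by (simp_all add: spider_def)

lemma spider_intros:
  assumes "spider n k v A"
  shows "i < n \<Longrightarrow> j \<le> k \<Longrightarrow> v i j \<in> points A"
    and "i < n \<Longrightarrow> j \<le> k \<Longrightarrow> j' \<le> k \<Longrightarrow> j' = j \<or> j' = Suc j \<Longrightarrow> (v i j, v i j') \<in> relR A"
    and "i \<le> i' \<Longrightarrow> i' < n \<Longrightarrow> j \<le> k \<Longrightarrow> j' \<le> k \<Longrightarrow> (v i j, v i' j') \<in> relS A"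
  unfolding spiderD(4-6)[OF assms] by blast+

text \<open>Branches beyond the legs of the word go to the root of the target; as it lies on every
  branch, they do not disturb the order S.\<close>

definition word_map :: "(nat \<Rightarrow> nat \<Rightarrow> 'a) \<Rightarrow> word \<Rightarrow> nat \<Rightarrow> nat \<Rightarrow> 'a" where
  "word_map v x i j =
     (if i < length (fst x) then v (fst (fst x ! i)) (snd (fst x ! i) j) else v 0 0)"

definition word_epi ::
  "nat RS_structure \<Rightarrow> (nat \<Rightarrow> nat \<Rightarrow> nat) \<Rightarrow> nat \<Rightarrow> nat \<Rightarrow> (nat \<Rightarrow> nat \<Rightarrow> 'a) \<Rightarrow> word \<Rightarrow> nat \<Rightarrow> 'a" where
  "word_epi C vC N M v x = restrict (\<lambda>c. let (i, j) = SOME (i, j). i < N \<and> j \<le> M \<and> vC i j = c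
     in word_map v x i j) (points C)"

text \<open>Only the root has several coordinates, and there every word gives the root because step
  functions vanish at 0. So the choice made in \<open>word_epi\<close> is harmless.\<close>

lemma word_epi_apply:
  assumes C: "spider N M vC C" and A: "spider n k v A" and x: "valid_word n k x"
    and "i < N" "j \<le> M"
  shows "word_epi C vC N M v x (vC i j) = word_map v x i j"
proof -
  have zero: "word_map v x i 0 = v 0 0" for i
  proof (cases "i < length (fst x)")
    case True
    obtain a q where aq: "fst x ! i = (a, q)" by fastforce
    then have "(a, q) \<in> set (fst x)" using nth_mem[OF True] by simp
    then have "a < n" "q 0 = 0" using x by (auto simp: valid_word_def step_fun_def)
    then show ?thesis
      using True spiderD(1)[OF A] spiderD(3)[OF A, of a 0 0 0] by (simp add: word_map_def aq)
  qed (simp add: word_map_def)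
  obtain i' j' where ij': "(SOME (i', j'). i' < N \<and> j' \<le> M \<and> vC i' j' = vC i j) = (i', j')"
    by fastforce
  have "case (SOME (i', j'). i' < N \<and> j' \<le> M \<and> vC i' j' = vC i j) of
      (i', j') \<Rightarrow> i' < N \<and> j' \<le> M \<and> vC i' j' = vC i j"
    by (rule someI[of _ "(i, j)"]) (use assms in auto)
  then have "i' < N" "j' \<le> M" "vC i' j' = vC i j" by (auto simp: ij')
  then have "j' = j \<and> (j = 0 \<or> i' = i)" using spiderD(3)[OF C, of i' i j' j] assms(4,5) by blast
  then have "word_map v x i' j' = word_map v x i j" using zero by auto
  moreover have "vC i j \<in> points C" using assms(4,5) by (rule spider_intros(1)[OF C])
  ultimately show ?thesis by (simp add: word_epi_def ij')
qed

lemma word_epi_in_epis: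
  assumes C: "spider N M vC C" and A: "spider n k v A" and x: "valid_word n k x"
    and len: "length (fst x) \<le> N" and tot: "snd x \<le> M"
  shows "word_epi C vC N M v x \<in> epis C A"
proof -
  define f where "f = word_epi C vC N M v x"
  \<comment> \<open>Surplus branches formally get the last label, which keeps the labels weakly
    increasing; their function is 0, so they stay at the root.\<close>
  define lab where "lab i = (if i < length (fst x) then fst (fst x ! i) else n - 1)" for i
  define fn where "fn i = (if i < length (fst x) then snd (fst x ! i) else (\<lambda>_. 0))" for i
  note inj = spiderD(3)[OF A]
  have n: "1 \<le> n" using spiderD(1)[OF A] .
  have nth: "(lab i, fn i) \<in> set (fst x)" if "i < length (fst x)" for i
    using that by (simp add: lab_def fn_def)
  have lab: "lab i < n" for i
    using x nth[of i] n by (cases "i < length (fst x)") (auto simp: valid_word_def lab_def)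
  have step: "step_fun (fn i)" "fn i t \<le> k" for i t
    using x nth[of i] by (cases "i < length (fst x)"; auto simp: valid_word_def fn_def step_fun_def)+
  have f: "f (vC i j) = v (lab i) (fn i j)" if "i < N" "j \<le> M" for i j
    using word_epi_apply[OF C A x that] inj[of "n - 1" 0 0 0] n
    by (auto simp: f_def word_map_def lab_def fn_def)
  have lab_mono: "lab i \<le> lab i'" if "i \<le> i'" for i i'
  proof (cases "i' < length (fst x)")
    case True
    then show ?thesis
      using x that sorted_nth_mono[of "map fst (fst x)" i i'] by (simp add: valid_word_def lab_def)
  next
    case False
    then show ?thesis using lab[of i] by (auto simp: lab_def)
  qed
  have "\<exists>i. i < length (fst x) \<and> lab i = a \<and> fn i (snd x) = k" if a: "a < n" for a
  proof -
    obtain q where "(a, q) \<in> set (fst x)" "q (snd x) = k" using x a by (auto simp: valid_word_def)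
    then obtain i where "i < length (fst x)" "fst x ! i = (a, q)" by (auto simp: in_set_conv_nth)
    then show ?thesis using \<open>q (snd x) = k\<close> by (intro exI[of _ i]) (simp add: lab_def fn_def)
  qed
  then obtain I where I: "\<And>a. a < n \<Longrightarrow> I a < length (fst x) \<and> lab (I a) = a \<and> fn (I a) (snd x) = k"
    by metis
  have hit: "\<exists>s \<le> M. fn (I a) s = t \<and> (t < k \<longrightarrow> Suc s \<le> M \<and> fn (I a) (Suc s) = Suc t)"
    if "a < n" "t \<le> k" for a t
  proof -
    \<comment> \<open>For \<open>t < k\<close> the leg has value \<open>t\<close> at this last
      height and \<open>Suc t\<close> right after it, so the R-pair from \<open>t\<close> to
      \<open>Suc t\<close> is lifted too.\<close>
    define s where "s = (GREATEST s. fn (I a) s \<le> t \<and> s \<le> snd x)"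
    have z: "fn (I a) 0 \<le> t \<and> 0 \<le> snd x" using step(1)[of "I a"] by (simp add: step_fun_def)
    have s: "fn (I a) s \<le> t" "s \<le> snd x" "\<And>s'. fn (I a) s' \<le> t \<Longrightarrow> s' \<le> snd x \<Longrightarrow> s' \<le> s"
      using GreatestI_nat[of "\<lambda>s. fn (I a) s \<le> t \<and> s \<le> snd x" 0 "snd x"] z
        Greatest_le_nat[of "\<lambda>s. fn (I a) s \<le> t \<and> s \<le> snd x" _ "snd x"]
      by (auto simp: s_def)
    have full: "fn (I a) (snd x) = k" using I[OF that(1)] by simp
    show ?thesis
    proof (cases "t = k")
      case True
      then show ?thesis using full tot by auto
    next
      case False
      then have "s < snd x" using s full that(2) by (metis le_antisym le_neq_implies_less)
      then have "\<not> fn (I a) (Suc s) \<le> t" using s(3)[of "Suc s"] by auto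
      moreover have "fn (I a) (Suc s) \<le> Suc (fn (I a) s)" using step(1)[of "I a"] by (simp add: step_fun_def)
      ultimately have "fn (I a) s = t \<and> fn (I a) (Suc s) = Suc t" using s(1) by linarith
      then show ?thesis using \<open>s < snd x\<close> tot by (intro exI[of _ s]) auto
    qed
  qed
  have IN: "I a < N" if "a < n" for a using I[OF that] len by auto
  have pC: "points C = {vC i j | i j. i < N \<and> j \<le> M}" and pA: "points A = {v i j | i j. i < n \<and> j \<le> k}"
    using spiderD(4)[OF C] spiderD(4)[OF A] .
  have fI: "f (vC (I a) s) = v a (fn (I a) s)" if "a < n" "s \<le> M" for a s
    using f[OF IN that(2)] I[OF that(1)] that by simp
  have "f ` points C = points A"
  proof
    show "f ` points C \<subseteq> points A"
      using f lab step(2) by (auto simp: pC intro!: spider_intros(1)[OF A])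
    show "points A \<subseteq> f ` points C"
    proof
      fix y assume "y \<in> points A"
      then obtain a t where at: "y = v a t" "a < n" "t \<le> k" by (auto simp: pA)
      then obtain s where "s \<le> M" "fn (I a) s = t" using hit by blast
      then have "y = f (vC (I a) s)" "vC (I a) s \<in> points C"
        using fI at IN by (auto intro: spider_intros(1)[OF C])
      then show "y \<in> f ` points C" by blast
    qed
  qed
  moreover have "reflects_onto f (points C) (relR C) (points A) (relR A)"
    unfolding reflects_onto_def
  proof (intro ballI iffI)
    fix y z assume "(y, z) \<in> relR A"
    then obtain a t t' where at: "y = v a t" "z = v a t'" "a < n" "t \<le> k" "t' \<le> k" "t' = t \<or> t' = Suc t"
      by (auto simp: spiderD(5)[OF A])
    then obtain s where s: "s \<le> M" "fn (I a) s = t" "t < k \<longrightarrow> Suc s \<le> M \<and> fn (I a) (Suc s) = Suc t"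
      using hit by blast
    define s' where "s' = (if t' = t then s else Suc s)"
    have s': "s' \<le> M" "fn (I a) s' = t'" "s' = s \<or> s' = Suc s"
      using s at by (auto simp: s'_def)
    have "(vC (I a) s, vC (I a) s') \<in> relR C"
      using s s' IN[of a] at by (intro spider_intros(2)[OF C]) auto
    moreover have "f (vC (I a) s) = y" "f (vC (I a) s') = z" using fI at s s' by auto
    moreover have "vC (I a) s \<in> points C" "vC (I a) s' \<in> points C"
      using s s' IN at by (auto intro: spider_intros(1)[OF C])
    ultimately show "\<exists>x' \<in> points C. \<exists>y' \<in> points C. f x' = y \<and> f y' = z \<and> (x', y') \<in> relR C"
      by blast
  next
    fix y z assume "\<exists>x' \<in> points C. \<exists>y' \<in> points C. f x' = y \<and> f y' = z \<and> (x', y') \<in> relR C"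
    then obtain i s s' where i: "i < N" "s \<le> M" "s' \<le> M" "s' = s \<or> s' = Suc s"
      and yz: "y = f (vC i s)" "z = f (vC i s')"
      by (auto simp: spiderD(5)[OF C])
    have "fn i s' = fn i s \<or> fn i s' = Suc (fn i s)"
      using i(4) step_fun_Suc_cases[OF step(1)[of i], of s] by auto
    then show "(y, z) \<in> relR A"
      using yz i f lab[of i] step(2)[of i] spider_intros(2)[OF A, of "lab i" "fn i s" "fn i s'"] by simp
  qed
  moreover have "reflects_onto f (points C) (relS C) (points A) (relS A)"
    unfolding reflects_onto_def
  proof (intro ballI iffI)
    fix y z assume "(y, z) \<in> relS A"
    then obtain a a' t t' where at: "y = v a t" "z = v a' t'" "a \<le> a'" "a' < n" "t \<le> k" "t' \<le> k"
      by (auto simp: spiderD(6)[OF A])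
    then have "a < n" by simp
    obtain s s' where s: "s \<le> M" "fn (I a) s = t" "s' \<le> M" "fn (I a') s' = t'"
      using hit at \<open>a < n\<close> by meson
    have "I a \<le> I a'"
    proof (cases "a = a'")
      case False
      then have "\<not> I a' \<le> I a" using lab_mono[of "I a'" "I a"] I at \<open>a < n\<close> by auto
      then show ?thesis by simp
    qed simp
    then have "(vC (I a) s, vC (I a') s') \<in> relS C"
      using s IN at by (intro spider_intros(3)[OF C]) auto
    moreover have "f (vC (I a) s) = y" "f (vC (I a') s') = z" using fI at s \<open>a < n\<close> by auto
    moreover have "vC (I a) s \<in> points C" "vC (I a') s' \<in> points C" 
      using s IN at \<open>a < n\<close> by (auto intro: spider_intros(1)[OF C])
    ultimately show "\<exists>x' \<in> points C. \<exists>y' \<in> points C. f x' = y \<and> f y' = z \<and> (x', y') \<in> relS C"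
      by blast
  next
    fix y z assume "\<exists>x' \<in> points C. \<exists>y' \<in> points C. f x' = y \<and> f y' = z \<and> (x', y') \<in> relS C"
    then obtain i i' s s' where i: "i \<le> i'" "i' < N" "s \<le> M" "s' \<le> M"
      and yz: "y = f (vC i s)" "z = f (vC i' s')"
      by (auto simp: spiderD(6)[OF C])
    have "y = v (lab i) (fn i s)" "z = v (lab i') (fn i' s')"
      using yz i f by auto
    then show "(y, z) \<in> relS A"
      using lab_mono[OF i(1)] lab[of i'] step(2) by (auto intro: spider_intros(3)[OF A])
  qed
  moreover have "f \<in> extensional (points C)" by (simp add: f_def word_epi_def)
  ultimately show ?thesis by (simp add: epis_def f_def)
qed

lemma reflects_ontoD:
  assumes "reflects_onto f V Q V' Q'" "f ` V = V'" "x \<in> V" "y \<in> V" "(x, y) \<in> Q"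
  shows "(f x, f y) \<in> Q'"
proof -
  have "f x \<in> V'" "f y \<in> V'" using assms(2-4) by auto
  then show ?thesis using assms(1,3-5) unfolding reflects_onto_def by blast
qed

lemma epis_compose:
  assumes "g \<in> epis C B" "f \<in> epis B A"
  shows "compose (points C) f g \<in> epis C A"
proof -
  have refl: "reflects_onto (compose (points C) f g) (points C) Q (points A) Q''"
    if g: "reflects_onto g (points C) Q (points B) Q'" and f: "reflects_onto f (points B) Q' (points A) Q''"
    for Q Q' Q''
    unfolding reflects_onto_def
  proof (intro ballI iffI)
    fix x y assume xy: "x \<in> points A" "y \<in> points A"
    {
      assume "(x, y) \<in> Q''"
      then obtain x1 y1 where 1: "x1 \<in> points B" "y1 \<in> points B" "f x1 = x" "f y1 = y" "(x1, y1) \<in> Q'"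
        using f xy unfolding reflects_onto_def by meson
      then obtain x2 y2 where "x2 \<in> points C" "y2 \<in> points C" "g x2 = x1" "g y2 = y1" "(x2, y2) \<in> Q"
        using g unfolding reflects_onto_def by meson
      with 1 show "\<exists>x' \<in> points C. \<exists>y' \<in> points C. compose (points C) f g x' = x \<and>
        compose (points C) f g y' = y \<and> (x', y') \<in> Q"
        by (intro bexI[of _ x2] bexI[of _ y2]) (auto simp: compose_def)
    }
    assume "\<exists>x' \<in> points C. \<exists>y' \<in> points C. compose (points C) f g x' = x \<and>
      compose (points C) f g y' = y \<and> (x', y') \<in> Q"
    then obtain x2 y2 where 2: "x2 \<in> points C" "y2 \<in> points C" "f (g x2) = x" "f (g y2) = y" "(x2, y2) \<in> Q"
      by (auto simp: compose_def)
    have gB: "g x2 \<in> points B" "g y2 \<in> points B" using assms(1) 2 by (auto simp: epis_def)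
    then have "(g x2, g y2) \<in> Q'" using g 2 unfolding reflects_onto_def by blast
    then show "(x, y) \<in> Q''" using f xy gB 2 unfolding reflects_onto_def by blast
  qed
  have "compose (points C) f g ` points C = f ` (g ` points C)"
    by (auto simp: compose_def)
  then show ?thesis
    using assms refl by (auto simp: epis_def compose_def)
qed

text \<open>R lets the image of a branch climb by at most one level per step, along a single branch
  of \<open>A\<close>; S keeps these branches in order; surjectivity makes some branch reach each
  tip.\<close>

lemma epi_letters:
  assumes B: "spider m K vB B" and A: "spider n k v A" and f: "f \<in> epis B A"
  shows "\<exists>\<sigma>. length \<sigma> = m \<and> valid_letters n k K \<sigma> \<and>
    (\<forall>b < m. \<forall>j \<le> K. f (vB b j) = v (fst (\<sigma> ! b)) (snd (\<sigma> ! b) j))"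
proof -
  note inj = spiderD(3)[OF A]
  have n: "1 \<le> n" and m: "1 \<le> m" using spiderD(1)[OF A] spiderD(1)[OF B] .
  have pB: "points B = {vB i j | i j. i < m \<and> j \<le> K}" and pA: "points A = {v i j | i j. i < n \<and> j \<le> k}"
    using spiderD(4)[OF B] spiderD(4)[OF A] .
  have onto: "f ` points B = points A"
    and fR: "\<And>x y. x \<in> points B \<Longrightarrow> y \<in> points B \<Longrightarrow> (x, y) \<in> relR B \<Longrightarrow> (f x, f y) \<in> relR A"
    and fS: "\<And>x y. x \<in> points B \<Longrightarrow> y \<in> points B \<Longrightarrow> (x, y) \<in> relS B \<Longrightarrow> (f x, f y) \<in> relS A"
    using f by (auto simp: epis_def intro: reflects_ontoD)
  have B_pt: "vB b j \<in> points B" if "b < m" "j \<le> K" for b j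
    using that by (rule spider_intros(1)[OF B])
  have "\<exists>a t. f (vB b j) = v a t \<and> a < n \<and> t \<le> k" if "b < m" "j \<le> K" for b j
  proof -
    have "f (vB b j) \<in> points A" using onto B_pt[OF that] by blast
    then show ?thesis by (auto simp: pA)
  qed
  then obtain leg dep where f_eq: "\<And>b j. b < m \<Longrightarrow> j \<le> K \<Longrightarrow>
      f (vB b j) = v (leg b j) (dep b j) \<and> leg b j < n \<and> dep b j \<le> k"
    by metis
  have R_step: "(dep b (Suc j) = dep b j \<or> dep b (Suc j) = Suc (dep b j)) \<and>
      (dep b j = 0 \<or> leg b (Suc j) = leg b j)"
    if bj: "b < m" "Suc j \<le> K" for b j
  proof -
    have "(vB b j, vB b (Suc j)) \<in> relR B" using bj by (intro spider_intros(2)[OF B]) auto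
    then have "(f (vB b j), f (vB b (Suc j))) \<in> relR A" using fR B_pt bj by auto
    then obtain a t t' where a: "f (vB b j) = v a t" "f (vB b (Suc j)) = v a t'" "a < n" "t \<le> k" "t' \<le> k"
      "t' = t \<or> t' = Suc t"
      by (auto simp: spiderD(5)[OF A])
    have "dep b j = t \<and> (dep b j = 0 \<or> leg b j = a)"
      using a f_eq[of b j] inj[of "leg b j" a "dep b j" t] bj by auto
    moreover have "dep b (Suc j) = t' \<and> (dep b (Suc j) = 0 \<or> leg b (Suc j) = a)"
      using a f_eq[of b "Suc j"] inj[of "leg b (Suc j)" a "dep b (Suc j)" t'] bj by auto
    ultimately show ?thesis using a(6) by auto
  qed
  have dep_mono: "dep b j \<le> dep b j'" if "j \<le> j'" "j' \<le> K" "b < m" for b j j'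
    using that(1,2)
  proof (induction j' rule: dec_induct)
    case (step i)
    then show ?case using R_step[of b i] that(3) by auto
  qed simp
  \<comment> \<open>Some point maps to the root of \<open>A\<close>; since depth does not decrease
    along its branch, the root of \<open>B\<close>, common to all branches, maps there as
    well.\<close>
  have root: "dep b 0 = 0" if "b < m" for b
  proof -
    have "v 0 0 \<in> points A" using n by (intro spider_intros(1)[OF A]) auto
    then obtain x where "x \<in> points B" "f x = v 0 0" using onto by (metis imageE)
    then obtain b' j where b': "b' < m" "j \<le> K" "f (vB b' j) = v 0 0" by (auto simp: pB)
    then have "dep b' j = 0" using f_eq[of b' j] inj[of "leg b' j" 0 "dep b' j" 0] n by auto
    then have "dep b' 0 = 0" using dep_mono[of 0 j b'] b' by auto
    then have "f (vB b' 0) = v 0 0" using f_eq[of b' 0] inj[of "leg b' 0" 0 0 0] n b' by auto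
    moreover have "vB b 0 = vB b' 0" using spiderD(3)[OF B] that b' by auto
    ultimately show ?thesis using f_eq[of b 0] inj[of "leg b 0" 0 "dep b 0" 0] n that by auto
  qed
  \<comment> \<open>Constant continuation beyond \<open>K\<close> gives a step function on all
    heights.\<close>
  define p where "p b j = dep b (min j K)" for b j
  \<comment> \<open>A branch collapsed to the root determines no label. The running maximum of the
    labels of non-collapsed branches supplies one and keeps the list sorted; S ensures that it
    agrees with the actual label wherever there is one.\<close>
  define lab where "lab b = Max (insert 0 {leg b' K | b'. b' \<le> b \<and> 0 < dep b' K})" for b
  have fin: "finite (insert 0 {leg b' K | b'. b' \<le> b \<and> 0 < dep b' K})" for b by simp
  have S_legs: "leg b K \<le> leg b' K" if "b \<le> b'" "b' < m" "0 < dep b K" "0 < dep b' K" for b b'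
  proof -
    have "(vB b K, vB b' K) \<in> relS B" using that by (intro spider_intros(3)[OF B]) auto
    then have "(f (vB b K), f (vB b' K)) \<in> relS A" using fS B_pt that by auto
    then obtain a a' t t' where a: "f (vB b K) = v a t" "f (vB b' K) = v a' t'" "a \<le> a'" "a' < n" "t \<le> k" "t' \<le> k"
      by (auto simp: spiderD(6)[OF A])
    have "leg b K = a" using a f_eq[of b K] inj[of "leg b K" a "dep b K" t] that by auto
    moreover have "leg b' K = a'" using a f_eq[of b' K] inj[of "leg b' K" a' "dep b' K" t'] that by auto
    ultimately show ?thesis using a by simp
  qed
  have lab_eq: "lab b = leg b K" if "b < m" "0 < dep b K" for b
    unfolding lab_def
  proof (rule Max_eqI[OF fin])
    show "y \<le> leg b K" if "y \<in> insert 0 {leg b' K | b'. b' \<le> b \<and> 0 < dep b' K}" for y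
      using that S_legs \<open>b < m\<close> \<open>0 < dep b K\<close> by auto
    show "leg b K \<in> insert 0 {leg b' K | b'. b' \<le> b \<and> 0 < dep b' K}" using that by auto
  qed
  have lab_less: "lab b < n" if "b < m" for b
    unfolding lab_def using f_eq that n by (subst Max_less_iff[OF fin]) auto
  have lab_mono: "lab b \<le> lab b'" if "b \<le> b'" for b b'
    unfolding lab_def by (rule Max_mono[OF _ _ fin]) (use that in auto)
  have legs: "dep b j = 0 \<or> leg b j = leg b K" if "b < m" "j \<le> K" for b j
    using that(2)
  proof (induction j rule: inc_induct)
    case (step i)
    then show ?case using R_step[of b i] dep_mono[of i "Suc i" b] that(1) by auto
  qed simp
  have f_lab: "f (vB b j) = v (lab b) (p b j)" if "b < m" "j \<le> K" for b j
  proof (cases "dep b j = 0")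
    case True
    then show ?thesis
      using f_eq[OF that] lab_less[OF that(1)] inj[of "leg b j" "lab b" 0 0] that by (auto simp: p_def)
  next
    case False
    then have "0 < dep b K" using dep_mono[of j K b] that by auto
    then show ?thesis using f_eq[OF that] legs[OF that] False lab_eq[of b] that by (auto simp: p_def)
  qed
  have p_step: "step_fun (p b)" if "b < m" for b
    unfolding step_fun_def
  proof (intro conjI allI)
    show "p b 0 = 0" using root[OF that] by (simp add: p_def)
    fix t
    have "p b (Suc t) = p b t \<or> p b (Suc t) = Suc (p b t)"
      using R_step[of b t] that by (cases "Suc t \<le> K") (auto simp: p_def min_def not_less_eq_eq)
    then show "p b t \<le> p b (Suc t)" "p b (Suc t) \<le> Suc (p b t)" by auto
  qed
  \<comment> \<open>For \<open>k > 0\<close> the tip \<open>v a k\<close> determines its branch; for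
    \<open>k = 0\<close> there is only the branch 0.\<close>
  have full: "\<exists>b < m. lab b = a \<and> p b K = k" if "a < n" for a
  proof (cases "k = 0")
    case True
    then have "n = 1" using spiderD(2)[OF A] by simp
    then have "lab 0 = a" using lab_less[of 0] m that by auto
    moreover have "p 0 K = k" using f_eq[of 0 K] m True by (auto simp: p_def)
    ultimately show ?thesis using m by (intro exI[of _ 0]) auto
  next
    case False
    have "v a k \<in> points A" using that by (intro spider_intros(1)[OF A]) auto
    then obtain x where "x \<in> points B" "f x = v a k" using onto by (metis imageE)
    then obtain b j where b: "b < m" "j \<le> K" "f (vB b j) = v a k" by (auto simp: pB)
    then have 1: "dep b j = k" "leg b j = a"
      using f_eq[of b j] inj[of "leg b j" a "dep b j" k] that False by auto
    then have "dep b K = k" using dep_mono[of j K b] b f_eq[of b K] by auto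
    moreover have "lab b = a" using legs[OF b(1,2)] 1 False lab_eq[of b] b \<open>dep b K = k\<close> by auto
    ultimately show ?thesis using b by (intro exI[of _ b]) (auto simp: p_def)
  qed
  define \<sigma> where "\<sigma> = map (\<lambda>b. (lab b, p b)) [0..<m]"
  have "valid_letters n k K \<sigma>"
    unfolding valid_letters_def
  proof (intro conjI)
    show "sorted (map fst \<sigma>)"
      by (simp add: \<sigma>_def comp_def sorted_iff_nth_mono lab_mono)
    show "\<forall>(a, p) \<in> set \<sigma>. a < n \<and> step_fun p \<and> p K \<le> k"
      using lab_less p_step f_eq[of _ K] by (auto simp: \<sigma>_def) (simp add: p_def)
    show "\<forall>a < n. \<exists>p. (a, p) \<in> set \<sigma> \<and> p K = k"
    proof (intro allI impI)
      fix a assume "a < n"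
      then obtain b where "b < m" "lab b = a" "p b K = k" using full by blast
      then show "\<exists>p. (a, p) \<in> set \<sigma> \<and> p K = k"
        by (intro exI[of _ "p b"]) (auto simp: \<sigma>_def)
    qed
  qed
  then show ?thesis using f_lab by (intro exI[of _ \<sigma>]) (auto simp: \<sigma>_def)
qed

section \<open>Coordinates from the tree order\<close>

text \<open>The last assumption is what the degree bound contributes: a non-root vertex spends one
  neighbour on its parent, which leaves at most one immediate successor. The others hold in every
  finite rooted tree.\<close>

locale tree_order =
  fixes V :: "'a set" and le :: "'a \<Rightarrow> 'a \<Rightarrow> bool" and r :: 'a
  assumes finite_V: "finite V"
    and le_V: "le x y \<Longrightarrow> x \<in> V \<and> y \<in> V"
    and le_refl: "x \<in> V \<Longrightarrow> le x x"
    and le_antisym: "le x y \<Longrightarrow> le y x \<Longrightarrow> x = y"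
    and le_trans: "le x y \<Longrightarrow> le y z \<Longrightarrow> le x z"
    and le_below: "le x z \<Longrightarrow> le y z \<Longrightarrow> le x y \<or> le y x"
    and root: "r \<in> V" "x \<in> V \<Longrightarrow> le r x"
    and unique_succ: "s \<noteq> r \<Longrightarrow>
      le s t \<and> s \<noteq> t \<and> \<not> (\<exists>u. u \<noteq> s \<and> u \<noteq> t \<and> le s u \<and> le u t) \<Longrightarrow>
      le s t' \<and> s \<noteq> t' \<and> \<not> (\<exists>u. u \<noteq> s \<and> u \<noteq> t' \<and> le s u \<and> le u t') \<Longrightarrow> t = t'"
begin

definition br :: "'a set set" where
  "br = {b. pred_on.maxchain V le b}"

definition depth :: "'a \<Rightarrow> nat" where
  "depth x = card {u. le u x \<and> u \<noteq> x}"

lemma br_chain: "b \<in> br \<Longrightarrow> b \<subseteq> V" "b \<in> br \<Longrightarrow> x \<in> b \<Longrightarrow> y \<in> b \<Longrightarrow> le x y \<or> le y x"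
  using le_refl by (auto simp: br_def pred_on.maxchain_def pred_on.chain_def)

lemma br_insert:
  assumes "b \<in> br" "y \<in> V" "\<And>u. u \<in> b \<Longrightarrow> le u y \<or> le y u"
  shows "y \<in> b"
proof (rule ccontr)
  assume "y \<notin> b"
  have "pred_on.chain V le (insert y b)"
    using assms br_chain[OF assms(1)] le_refl by (auto simp: pred_on.chain_def)
  then show False
    using assms(1) \<open>y \<notin> b\<close> by (auto simp: br_def pred_on.maxchain_def)
qed

lemma br_down:
  assumes "b \<in> br" "x \<in> b" "le y x"
  shows "y \<in> b"
proof (rule br_insert[OF assms(1)])
  show "y \<in> V" using le_V[OF assms(3)] by simp
  fix u assume "u \<in> b"
  then have "le u x \<or> le x u" using br_chain(2) assms by blast
  then show "le u y \<or> le y u" using le_below[OF _ assms(3)] le_trans[OF assms(3)] by blast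
qed

lemma br_root: "b \<in> br \<Longrightarrow> r \<in> b"
  by (rule br_insert) (use br_chain(1) root in auto)

lemma br_ex:
  assumes "x \<in> V"
  shows "\<exists>b \<in> br. x \<in> b"
proof -
  have "finite {c. pred_on.chain V le c}"
    by (rule finite_subset[of _ "Pow V"]) (auto simp: pred_on.chain_def finite_V)
  moreover have "{x} \<in> {c. pred_on.chain V le c}" using assms by (auto simp: pred_on.chain_def)
  ultimately obtain m where m: "pred_on.chain V le m" "{x} \<subseteq> m"
    "\<And>c. pred_on.chain V le c \<Longrightarrow> m \<subseteq> c \<Longrightarrow> c = m"
    by (metis (no_types, lifting) finite_has_maximal2 mem_Collect_eq)
  then show ?thesis by (intro bexI[of _ m]) (auto simp: br_def pred_on.maxchain_def)
qed

lemma finite_below: "finite {u. le u x \<and> u \<noteq> x}"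
  by (rule finite_subset[OF _ finite_V]) (auto dest: le_V)

lemma depth_less: "le x y \<Longrightarrow> x \<noteq> y \<Longrightarrow> depth x < depth y"
proof -
  assume xy: "le x y" "x \<noteq> y"
  have "{u. le u x \<and> u \<noteq> x} \<subseteq> {u. le u y \<and> u \<noteq> y}"
    using le_trans[OF _ xy(1)] le_antisym[OF xy(1)] xy(2) by blast
  moreover have "x \<in> {u. le u y \<and> u \<noteq> y} - {u. le u x \<and> u \<noteq> x}" using xy by simp
  ultimately show ?thesis
    unfolding depth_def by (intro psubset_card_mono[OF finite_below]) blast
qed

lemma depth_root: "depth r = 0"
proof -
  have "u = r" if "le u r" for u
    using le_antisym[OF that] root(2) le_V[OF that] by simp
  then have "{u. le u r \<and> u \<noteq> r} = {}" by auto
  then show ?thesis by (simp only: depth_def card.empty)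
qed

text \<open>A branch is a downward closed chain, so all predecessors of \<open>x\<close> lie in it;
  \<open>depth\<close> is thus injective into a range of the same size.\<close>

lemma depth_bij:
  assumes "b \<in> br"
  shows "bij_betw depth b {..card b - 1}"
proof -
  have fin: "finite b" using br_chain(1)[OF assms] finite_V finite_subset by blast
  have inj: "inj_on depth b"
    using br_chain(2)[OF assms] depth_less by (metis inj_onI less_irrefl)
  have "depth x \<le> card b - 1" if "x \<in> b" for x
  proof -
    have "depth x \<le> card (b - {x})"
      unfolding depth_def using br_down[OF assms that] fin by (intro card_mono) auto
    then show ?thesis using that fin by simp
  qed
  then have sub: "depth ` b \<subseteq> {..card b - 1}" by auto
  have "card b \<noteq> 0" using br_root[OF assms] fin by auto
  then have "card {..card b - 1} = card (depth ` b)" by (simp add: card_image[OF inj])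
  then have "depth ` b = {..card b - 1}" using sub by (intro card_subset_eq) auto
  then show ?thesis using inj by (simp add: bij_betw_def)
qed

text \<open>A branch through \<open>t\<close> has a vertex at every depth up to that of
  \<open>t\<close>, so a larger gap would leave room for a vertex strictly between.\<close>

lemma imm_iff:
  assumes "s \<in> V"
  shows "le s t \<and> s \<noteq> t \<and> \<not> (\<exists>u. u \<noteq> s \<and> u \<noteq> t \<and> le s u \<and> le u t) \<longleftrightarrow>
    le s t \<and> depth t = Suc (depth s)" (is "?L \<longleftrightarrow> ?R")
proof
  assume L: ?L
  then obtain b where b: "b \<in> br" "t \<in> b" using br_ex le_V by metis
  then have "s \<in> b" using L br_down by blast
  have lt: "depth s < depth t" using L depth_less by blast
  show ?R
  proof (rule ccontr)
    assume "\<not> ?R"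
    then have lt2: "Suc (depth s) < depth t" using L lt by auto
    have "depth t \<in> {..card b - 1}" using depth_bij[OF b(1)] b(2) bij_betwE by metis
    then have "Suc (depth s) \<in> depth ` b" using depth_bij[OF b(1)] lt2 by (auto simp: bij_betw_def)
    then obtain u where u: "u \<in> b" "depth u = Suc (depth s)" by force
    then have "le s u" "le u t"
      using br_chain(2)[OF b(1)] depth_less \<open>s \<in> b\<close> b(2) lt2
      by (metis less_asym lessI)+
    then show False using L u lt2 by auto
  qed
next
  assume R: ?R
  then show ?L using depth_less by (metis Suc_lessI less_irrefl less_trans_Suc n_not_Suc_n not_less_eq)
qed

text \<open>Below \<open>x\<close> both branches contain everything by downward closure. Above
  \<open>x\<close> unique immediate successors force agreement level by level, and equal size
  prevents one from ending early.\<close>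

lemma br_disjoint:
  assumes "b \<in> br" "b' \<in> br" "card b = card b'" "x \<in> b" "x \<in> b'" "x \<noteq> r"
  shows "b = b'"
proof -
  have "0 < depth x" using depth_less[of r x] root br_chain(1)[OF assms(1)] assms(4,6) by fastforce
  have "y \<in> b'" if "y \<in> b" "depth y = d" for y d
    using that
  proof (induction d arbitrary: y rule: less_induct)
    case (less d)
    show ?case
    proof (cases "depth y \<le> depth x")
      case True
      then have "le y x"
        using br_chain(2)[OF assms(1,4) less.prems(1)] depth_less[of x y] le_refl br_chain(1)[OF assms(1)] assms(4)
        by fastforce
      then show ?thesis using br_down assms by blast
    next
      case False
      have bij: "depth ` b = {..card b - 1}" "depth ` b' = {..card b - 1}"
        using depth_bij[OF assms(1)] depth_bij[OF assms(2)] assms(3) by (auto simp: bij_betw_def)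
      have dy: "depth y \<le> card b - 1" using bij(1) less.prems(1) by auto
      then have "depth y - 1 \<in> depth ` b" by (auto simp: bij)
      then obtain z where z: "z \<in> b" "depth z = depth y - 1" by force
      have "z \<in> b'" using less.IH[of "depth z" z] z False less.prems(2) by auto
      have "depth y \<in> depth ` b'" using dy by (auto simp: bij)
      then obtain y' where y': "y' \<in> b'" "depth y' = depth y" by force
      have d: "depth y = Suc (depth z)" "z \<noteq> r" using z False \<open>0 < depth x\<close> depth_root by auto
      have "le z y" "le z y'"
        using br_chain(2)[OF assms(1) z(1) less.prems(1)] br_chain(2)[OF assms(2) \<open>z \<in> b'\<close> y'(1)]
          depth_less d y' by (metis less_asym lessI)+
      then have "y = y'"
        using d y' imm_iff[of z y] imm_iff[of z y'] le_V[OF \<open>le z y\<close>]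
        by (intro unique_succ[OF d(2), of y y']) simp_all
      then show ?thesis using y' by simp
    qed
  qed
  then have "b \<subseteq> b'" by blast
  then show ?thesis
    using assms(3) finite_subset[OF br_chain(1)[OF assms(2)] finite_V] card_subset_eq by metis
qed

lemma tree_order_spider:
  assumes card: "\<And>b. b \<in> br \<Longrightarrow> card b = Suc k"
    and bs: "distinct bs" "set bs = br"
    and pA: "points A = V"
    and RA: "relR A = {(s, t). s \<in> V \<and> t \<in> V \<and>
      (s = t \<or> le s t \<and> s \<noteq> t \<and> \<not> (\<exists>u. u \<noteq> s \<and> u \<noteq> t \<and> le s u \<and> le u t))}"
    and SA: "relS A = {(x, y). x \<in> V \<and> y \<in> V \<and>
      (\<exists>i j. i \<le> j \<and> j < length bs \<and> x \<in> bs ! i \<and> y \<in> bs ! j)}"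
  shows "\<exists>v. spider (length bs) k v A"
proof -
  define n where "n = length bs"
  have bs_br: "bs ! i \<in> br" if "i < n" for i
    using nth_mem[of i bs] that bs(2) by (simp add: n_def)
  have bij: "bij_betw depth (bs ! i) {..k}" if "i < n" for i
    using depth_bij[OF bs_br[OF that]] card[OF bs_br[OF that]] by simp
  define v where "v i j = the_inv_into (bs ! i) depth j" for i j
  have v: "v i j \<in> bs ! i" "depth (v i j) = j" if "i < n" "j \<le> k" for i j
    using bij[OF that(1)] that(2)
    by (auto simp: v_def bij_betw_def intro: the_inv_into_into f_the_inv_into_f)
  have v_depth: "v i (depth x) = x" "depth x \<le> k" if "i < n" "x \<in> bs ! i" for i x
    using bij[OF that(1)] that(2) by (auto simp: v_def bij_betw_def the_inv_into_f_f)
  have bV: "x \<in> V" if "i < n" "x \<in> bs ! i" for i x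
    using br_chain(1)[OF bs_br[OF that(1)]] that(2) by auto
  have in_bs: "\<exists>i < n. x \<in> bs ! i" if "x \<in> V" for x
    using br_ex[OF that] bs(2) by (metis in_set_conv_nth n_def)
  have v0: "v i 0 = r" if "i < n" for i
    using v_depth(1)[OF that br_root[OF bs_br[OF that]]] depth_root by simp
  have n1: "1 \<le> n" using in_bs[OF root(1)] by auto
  have inj: "v i j = v i' j' \<longleftrightarrow> j = j' \<and> (j = 0 \<or> i = i')"
    if *: "i < n" "i' < n" "j \<le> k" "j' \<le> k" for i i' j j'
  proof
    assume eq: "v i j = v i' j'"
    then have "j = j'" using v(2)[OF *(1,3)] v(2)[OF *(2,4)] by simp
    moreover have "i = i'" if "j \<noteq> 0"
    proof -
      have "v i j \<noteq> r" using v(2)[OF *(1,3)] depth_root that by auto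
      then have "bs ! i = bs ! i'"
        using br_disjoint[OF bs_br[OF *(1)] bs_br[OF *(2)] _ v(1)[OF *(1,3)]] v(1)[OF *(2,4)] eq
          card[OF bs_br[OF *(1)]] card[OF bs_br[OF *(2)]] by simp
      then show ?thesis using nth_eq_iff_index_eq[OF bs(1)] * by (simp add: n_def)
    qed
    ultimately show "j = j' \<and> (j = 0 \<or> i = i')" by auto
  next
    assume "j = j' \<and> (j = 0 \<or> i = i')"
    then show "v i j = v i' j'" using v0 * by auto
  qed
  \<comment> \<open>All branches would be the set of the root alone, while the enumeration has no
    repetitions.\<close>
  have k0: "n = 1" if "k = 0"
  proof (rule ccontr)
    assume "n \<noteq> 1"
    then have "0 < n" "1 < n" using n1 by auto
    have "bs ! i = {r}" if "i < n" for i
      using card[OF bs_br[OF that]] br_root[OF bs_br[OF that]] \<open>k = 0\<close> by (auto simp: card_1_singleton_iff)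
    then have "bs ! 0 = bs ! 1" using \<open>0 < n\<close> \<open>1 < n\<close> by metis
    then show False using nth_eq_iff_index_eq[OF bs(1), of 0 1] \<open>0 < n\<close> \<open>1 < n\<close> by (simp add: n_def)
  qed
  have "points A = {v i j | i j. i < n \<and> j \<le> k}"
  proof
    show "points A \<subseteq> {v i j | i j. i < n \<and> j \<le> k}"
    proof
      fix x assume "x \<in> points A"
      then obtain i where "i < n" "x \<in> bs ! i" using in_bs pA by auto
      then show "x \<in> {v i j | i j. i < n \<and> j \<le> k}" using v_depth[of i x] by (metis (mono_tags, lifting) mem_Collect_eq)
    qed
  qed (use v bV pA in auto)
  moreover have "relR A = {(v i j, v i j') | i j j'. i < n \<and> j \<le> k \<and> j' \<le> k \<and> (j' = j \<or> j' = Suc j)}"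
    (is "_ = ?R")
  proof
    show "relR A \<subseteq> ?R"
    proof
      fix z assume "z \<in> relR A"
      then obtain s t where z: "z = (s, t)" "s \<in> V" "t \<in> V"
        and st: "s = t \<or> le s t \<and> depth t = Suc (depth s)"
        using imm_iff by (auto simp: RA)
      obtain i where i: "i < n" "t \<in> bs ! i" using in_bs[OF z(3)] by auto
      have "s \<in> bs ! i" using st i br_down[OF bs_br[OF i(1)] i(2)] by auto
      then have "s = v i (depth s)" "t = v i (depth t)" "depth s \<le> k" "depth t \<le> k"
        using v_depth i by auto
      moreover have "depth t = depth s \<or> depth t = Suc (depth s)" using st by auto
      ultimately show "z \<in> ?R" using i(1) z(1) by blast
    qed
    show "?R \<subseteq> relR A"
    proof
      fix z assume "z \<in> ?R"
      then obtain i j j' where z: "z = (v i j, v i j')" "i < n" "j \<le> k" "j' \<le> k" "j' = j \<or> j' = Suc j"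
        by blast
      have "v i j \<in> V" "v i j' \<in> V" using bV v z by auto
      moreover have "le (v i j) (v i j')" if "j' = Suc j"
        using br_chain(2)[OF bs_br[OF z(2)] v(1)[OF z(2,3)] v(1)[OF z(2,4)]]
          depth_less[of "v i j'" "v i j"] v(2)[OF z(2,3)] v(2)[OF z(2,4)] that by fastforce
      ultimately show "z \<in> relR A"
        using z(1,5) v(2)[OF z(2,3)] v(2)[OF z(2,4)] imm_iff[of "v i j" "v i j'"] by (auto simp: RA)
    qed
  qed
  moreover have "relS A = {(v i j, v i' j') | i i' j j'. i \<le> i' \<and> i' < n \<and> j \<le> k \<and> j' \<le> k}"
    (is "_ = ?S")
  proof
    show "relS A \<subseteq> ?S"
    proof
      fix z assume "z \<in> relS A"
      then obtain x y i i' where z: "z = (x, y)" "i \<le> i'" "i' < n" "x \<in> bs ! i" "y \<in> bs ! i'"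
        by (auto simp: SA n_def)
      then have "x = v i (depth x)" "y = v i' (depth y)" "depth x \<le> k" "depth y \<le> k"
        using v_depth[of i x] v_depth[of i' y] by auto
      then show "z \<in> ?S" using z by blast
    qed
    show "?S \<subseteq> relS A"
    proof
      fix z assume "z \<in> ?S"
      then obtain i i' j j' where z: "z = (v i j, v i' j')" "i \<le> i'" "i' < n" "j \<le> k" "j' \<le> k"
        by blast
      then have "v i j \<in> bs ! i" "v i' j' \<in> bs ! i'" using v by auto
      then show "z \<in> relS A"
        using z bV[of i "v i j"] bV[of i' "v i' j'"] by (auto simp: SA n_def)
    qed
  qed
  ultimately have "spider n k v A" using n1 k0 inj by (simp add: spider_def)
  then show ?thesis by (auto simp: n_def)
qed

end

section \<open>Fans\<close>

text \<open>Stopping at the first vertex in \<open>S\<close> keeps the initial segment otherwise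
  disjoint from \<open>S\<close>; this yields the distinct vertices of the cycle in
  \<open>apath_unique\<close>.\<close>

lemma (in pair_graph) apath_first_hit:
  assumes "apath x p r" "r \<in> S"
  shows "\<exists>p1 w p2. p = p1 @ p2 \<and> apath x p1 w \<and> w \<in> S \<and> set (pawalk_verts x p1) \<inter> S = {w}"
  using assms(1)
proof (induction p arbitrary: x)
  case Nil
  then show ?case using assms(2) by (intro exI[of _ "[]"] exI[of _ r]) (auto simp: apath_Nil_iff)
next
  case (Cons a p)
  show ?case
  proof (cases "x \<in> S")
    case True
    then show ?thesis
      using Cons.prems by (intro exI[of _ "[]"] exI[of _ x] exI[of _ "a # p"]) (auto simp: apath_Nil_iff apath_Cons_iff)
  next
    case False
    have a: "a \<in> parcs G" "fst a = x" "apath (snd a) p r" "x \<notin> set (pawalk_verts (snd a) p)"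
      using Cons.prems by (auto simp: apath_Cons_iff)
    from Cons.IH[OF a(3)] obtain p1 w p2 where
      *: "p = p1 @ p2" "apath (snd a) p1 w" "w \<in> S" "set (pawalk_verts (snd a) p1) \<inter> S = {w}"
      by blast
    have "set (pawalk_verts (snd a) p1) \<subseteq> set (pawalk_verts (snd a) p)"
      using a(3) *(1) by (auto simp: apath_def set_awalk_verts_append)
    then have "apath x (a # p1) w" using a * by (auto simp: apath_Cons_iff)
    moreover have "a # p = (a # p1) @ p2" using *(1) by simp
    moreover have "set (pawalk_verts x (a # p1)) \<inter> S = {w}" using *(4) a(2) False by simp
    ultimately show ?thesis using *(3) by blast
  qed
qed

text \<open>Two paths that leave \<open>t\<close> by different arcs meet again at the latest in
  \<open>r\<close>, and their parts up to the first meeting point close up to a cycle.\<close>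

lemma (in pair_graph) apath_unique:
  assumes acyc: "undirected_acyclic G" and "apath t p r" "apath t q r"
  shows "p = q"
  using assms(2,3)
proof (induction p arbitrary: t q)
  case Nil
  then show ?case using apath_nonempty_ends by (auto simp: apath_Nil_iff)
next
  case (Cons a p)
  show ?case
  proof (cases q)
    case Nil
    then show ?thesis using Cons.prems apath_nonempty_ends[OF Cons.prems(1)] by (auto simp: apath_Nil_iff)
  next
    case (Cons b q')
    have a: "a \<in> parcs G" "fst a = t" "apath (snd a) p r" "t \<notin> set (pawalk_verts (snd a) p)"
      using Cons.prems(1) by (auto simp: apath_Cons_iff)
    have b: "b \<in> parcs G" "fst b = t" "apath (snd b) q' r" "t \<notin> set (pawalk_verts (snd b) q')"
      using Cons.prems(2) Cons by (auto simp: apath_Cons_iff)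
    show ?thesis
    proof (cases "snd a = snd b")
      case True
      then have "a = b" using a b by (simp add: prod_eq_iff)
      then show ?thesis using Cons.IH[OF a(3), of q'] b Cons by simp
    next
      case False
      have "r \<in> set (pawalk_verts (snd b) q')" using b(3) by (auto simp: apath_def)
      from apath_first_hit[OF a(3) this] obtain p1 w p2 where
        p1: "p = p1 @ p2" "apath (snd a) p1 w" "w \<in> set (pawalk_verts (snd b) q')"
          "set (pawalk_verts (snd a) p1) \<inter> set (pawalk_verts (snd b) q') = {w}"
        by blast
      have "awalk (snd b) q' r" using b(3) by (simp add: apath_def)
      from awalk_decomp[OF this p1(3)] obtain q1 q2 where
        q1: "q' = q1 @ q2" "awalk (snd b) q1 w" "awalk w q2 r"
        by blast
      have q1v: "set (pawalk_verts (snd b) q1) \<subseteq> set (pawalk_verts (snd b) q')"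
        and p1v: "set (pawalk_verts (snd a) p1) \<subseteq> set (pawalk_verts (snd a) p)"
        using a(3) b(3) p1(1) q1(1) by (auto simp: apath_def set_awalk_verts_append)
      have q1d: "distinct (pawalk_verts (snd b) q1)"
        using b(3) q1 awalk_verts_append[of "snd b" q1 q2 r] by (auto simp: apath_def)
      have p1w: "awalk (snd a) p1 w" and p1d: "distinct (pawalk_verts (snd a) p1)"
        using p1(2) by (auto simp: apath_def)
      define c where "c = a # p1 @ rev_path q1 @ [(snd b, fst b)]"
      have ba: "(snd b, fst b) \<in> parcs G" using b(1) arcs_symmetric by (metis prod.collapse)
      have rw: "awalk w (rev_path q1) (snd b)" using q1(2) by simp
      have w3: "awalk (snd b) [(snd b, fst b)] t" using ba b by (auto simp: awalk_simps in_arcsD1 in_arcsD2)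
      have w2: "awalk w (rev_path q1 @ [(snd b, fst b)]) t" using awalk_appendI[OF rw w3] .
      have w1: "awalk (snd a) (p1 @ rev_path q1 @ [(snd b, fst b)]) t" using awalk_appendI[OF p1w w2] .
      have wc: "awalk t c t" unfolding c_def using w1 a by (simp add: awalk_Cons_iff del: awalk_append_iff)
      have "tl (pawalk_verts t c) = pawalk_verts (snd a) p1 @ tl (rev (pawalk_verts (snd b) q1)) @ [t]"
      proof -
        have "pawalk_verts (snd a) (p1 @ rev_path q1 @ [(snd b, fst b)]) =
            pawalk_verts (snd a) p1 @ tl (pawalk_verts w (rev_path q1 @ [(snd b, fst b)]))"
          using awalk_verts_append[OF w1] awlast_of_awalk[OF p1w] by simp
        moreover have "pawalk_verts w (rev_path q1 @ [(snd b, fst b)]) =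
            rev (pawalk_verts (snd b) q1) @ [t]"
          using awalk_verts_append[OF w2] awalk_verts_rev_path[OF q1(2)] awlast_of_awalk[OF rw] b(2)
          by simp
        ultimately show ?thesis by (simp add: c_def)
      qed
      moreover have "w \<notin> set (tl (rev (pawalk_verts (snd b) q1)))"
      proof -
        have "hd (rev (pawalk_verts (snd b) q1)) = w"
          using awlast_of_awalk[OF q1(2)] by (simp add: hd_rev)
        moreover have "distinct (rev (pawalk_verts (snd b) q1))" using q1d by simp
        ultimately show ?thesis
          by (metis awalk_verts_non_Nil distinct.simps(2) list.collapse rev_is_Nil_conv)
      qed
      moreover have "set (tl (rev (pawalk_verts (snd b) q1))) \<subseteq> set (pawalk_verts (snd b) q1)"
        by (metis list.set_sel(2) set_rev subsetI tl_Nil)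
      ultimately have "distinct (tl (pawalk_verts t c))"
        using p1d q1d p1(4) q1v p1v a(4) b(4) by (auto simp: distinct_tl)
      then have "cycle c" using wc by (auto simp: cycle_def c_def)
      \<comment> \<open>A shorter cycle would have both segments up to \<open>w\<close> empty, so
        that \<open>snd a = w = snd b\<close>.\<close>
      moreover have "length c \<ge> 3"
      proof (rule ccontr)
        assume "\<not> length c \<ge> 3"
        then have "p1 = []" "q1 = []"
          by (cases p1; cases "rev_path q1"; auto simp: c_def)+
        then show False using p1w q1(2) False by (auto simp: awalk_Nil_iff)
      qed
      ultimately show ?thesis using acyc by (auto simp: undirected_acyclic_def)
    qed
  qed
qed

text \<open>By uniqueness, the path from a vertex on \<open>P t\<close> is the remaining part of
  \<open>P t\<close>. The order laws thus reduce to those of the suffix order on lists.\<close>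

lemma (in pair_graph) tree_le_suffix:
  assumes acyc: "undirected_acyclic G" and P: "\<And>t. t \<in> pverts G \<Longrightarrow> apath t (P t) r"
  shows "tree_le G r s t \<longleftrightarrow> s \<in> pverts G \<and> t \<in> pverts G \<and> suffix (P s) (P t)"
proof
  assume "tree_le G r s t"
  then obtain p where p: "apath t p r" "s \<in> set (pawalk_verts t p)" by (auto simp: tree_le_def)
  then have "awalk t p r" by (simp add: apath_def)
  from awalk_decomp[OF this p(2)] obtain q1 q2 where q: "p = q1 @ q2" "awalk t q1 s" "awalk s q2 r"
    by blast
  then have "apath s q2 r" using p(1) by (auto simp: apath_append_iff)
  then have V: "s \<in> pverts G" "t \<in> pverts G" using p(1) by (auto simp: apath_def)
  have "P s = q2" using apath_unique[OF acyc P[OF V(1)] \<open>apath s q2 r\<close>] .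
  moreover have "P t = p" using apath_unique[OF acyc P[OF V(2)] p(1)] .
  ultimately show "s \<in> pverts G \<and> t \<in> pverts G \<and> suffix (P s) (P t)"
    using V q(1) by (auto simp: suffix_def)
next
  assume *: "s \<in> pverts G \<and> t \<in> pverts G \<and> suffix (P s) (P t)"
  then obtain q where q: "P t = q @ P s" by (auto simp: suffix_def)
  have "awalk t (q @ P s) r" "awalk s (P s) r" using P[of t] P[of s] * q by (auto simp: apath_def)
  then have w: "awalk t q (last (pawalk_verts t q))" "awalk (last (pawalk_verts t q)) (P s) r"
    by auto
  have "last (pawalk_verts t q) = s"
    using awalk_ends[OF w(2) \<open>awalk s (P s) r\<close>] by auto
  then have "s \<in> set (pawalk_verts t q)"
    using last_in_set[OF awalk_verts_non_Nil, of t q] by simp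
  then have "s \<in> set (pawalk_verts t (P t))"
    using set_awalk_verts_append[OF w] q by simp
  then show "tree_le G r s t" using P[of t] * by (auto simp: tree_le_def)
qed

lemma fan_tree_order:
  assumes "fan G r"
  shows "tree_order (pverts G) (tree_le G r) r"
proof -
  interpret pair_graph G using assms by (simp add: fan_def)
  have acyc: "undirected_acyclic G" and conn: "connected (with_proj G)" and rV: "r \<in> pverts G"
    and deg: "\<And>v. v \<in> pverts G \<Longrightarrow> v \<noteq> r \<Longrightarrow> out_degree (with_proj G) v \<le> 2"
    using assms by (auto simp: fan_def)
  have "\<exists>p. apath t p r" if "t \<in> pverts G" for t
  proof -
    have "strongly_connected (with_proj G)"
      by (rule symmetric_connected_imp_strongly_connected[OF pair_sym_arcs conn])
    then have "t \<rightarrow>\<^sup>*\<^bsub>with_proj G\<^esub> r" using that rV by (auto simp: strongly_connected_def)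
    then show ?thesis by (simp add: reachable_apath)
  qed
  then obtain P where P: "\<And>t. t \<in> pverts G \<Longrightarrow> apath t (P t) r" by metis
  note le = tree_le_suffix[OF acyc P]
  have P_eq: "P t = p" if "apath t p r" for t p
    using apath_unique[OF acyc P that] that by (auto simp: apath_def)
  have Pr: "P r = []" by (rule P_eq) (simp add: apath_Nil_iff rV)
  have P_inj: "s = t" if "s \<in> pverts G" "t \<in> pverts G" "P s = P t" for s t
    using apath_ends[OF P[OF that(1)]] P[OF that(2)] that(3) by metis
  \<comment> \<open>Otherwise the second vertex on the path from \<open>t\<close> would lie strictly
    between \<open>s\<close> and \<open>t\<close>.\<close>
  have imm_path: "P t = (t, s) # P s \<and> (t, s) \<in> parcs G"
    if imm: "tree_le G r s t \<and> s \<noteq> t \<and> \<not> (\<exists>u. u \<noteq> s \<and> u \<noteq> t \<and> tree_le G r s u \<and> tree_le G r u t)"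
    for s t
  proof -
    have V: "s \<in> pverts G" "t \<in> pverts G" and "suffix (P s) (P t)" using imm le by auto
    then obtain q where q: "P t = q @ P s" by (auto simp: suffix_def)
    have "q \<noteq> []" using q P_inj[OF V] imm by auto
    then obtain a q' where a: "q = a # q'" by (cases q) auto
    have aP: "a \<in> parcs G" "fst a = t" "apath (snd a) (q' @ P s) r"
      using P[OF V(2)] by (auto simp: q a apath_Cons_iff)
    have Pu: "P (snd a) = q' @ P s" by (rule P_eq[OF aP(3)])
    have uV: "snd a \<in> pverts G" using aP(1) by (rule arc_snd_in_verts)
    have "tree_le G r s (snd a)" "tree_le G r (snd a) t"
      using V uV by (auto simp: le Pu q a suffix_def)
    moreover have "snd a \<noteq> t" using pair_no_loops[OF aP(1)] aP(2) by simp
    ultimately have "snd a = s" using imm by blast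
    then have "q' = []" using Pu by simp
    then show ?thesis using aP q a \<open>snd a = s\<close> by (cases a) auto
  qed
  show ?thesis
  proof
    show "finite (pverts G)" by (rule pair_finite_verts)
    show "x \<in> pverts G \<and> y \<in> pverts G" if "tree_le G r x y" for x y
      using that by (simp add: le)
    show "tree_le G r x x" if "x \<in> pverts G" for x
      using that by (simp add: le)
    show "x = y" if "tree_le G r x y" "tree_le G r y x" for x y
      using that by (auto simp: le intro!: P_inj suffix_order.antisym)
    show "tree_le G r x z" if "tree_le G r x y" "tree_le G r y z" for x y z
      using that by (auto simp: le intro: suffix_order.trans)
    show "tree_le G r x y \<or> tree_le G r y x" if "tree_le G r x z" "tree_le G r y z" for x y z
      using that by (auto simp: le dest: suffix_same_cases)
    show "r \<in> pverts G" by (rule rV)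
    show "tree_le G r r x" if "x \<in> pverts G" for x
      using that rV by (simp add: le Pr)
    fix s t t'
    assume "s \<noteq> r"
      and t: "tree_le G r s t \<and> s \<noteq> t \<and> \<not> (\<exists>u. u \<noteq> s \<and> u \<noteq> t \<and> tree_le G r s u \<and> tree_le G r u t)"
      and t': "tree_le G r s t' \<and> s \<noteq> t' \<and> \<not> (\<exists>u. u \<noteq> s \<and> u \<noteq> t' \<and> tree_le G r s u \<and> tree_le G r u t')"
    have V: "s \<in> pverts G" "t \<in> pverts G" "t' \<in> pverts G" using t t' by (auto simp: le)
    have "P s \<noteq> []" using P[OF V(1)] \<open>s \<noteq> r\<close> by (auto simp: apath_Nil_iff)
    then obtain e ps where "P s = e # ps" by (cases "P s") auto
    then obtain z where z: "P s = (s, z) # ps" "(s, z) \<in> parcs G"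
      using P[OF V(1)] by (cases e) (auto simp: apath_Cons_iff)
    have z_ne: "z \<noteq> w" if "P w = (w, s) # P s" "w \<in> pverts G" for w
      using P[OF that(2)] by (auto simp: that(1) z(1) apath_Cons_iff hd_in_awalk_verts)
    show "t = t'"
    proof (rule ccontr)
      assume "t \<noteq> t'"
      \<comment> \<open>With the next vertex \<open>z\<close> towards the root, two immediate
        successors would give \<open>s\<close> three neighbours; \<open>z\<close> differs from them
        because a path repeats no vertex.\<close>
      have "{(s, t), (s, t'), (s, z)} \<subseteq> out_arcs (with_proj G) s"
        using imm_path[OF t] imm_path[OF t'] z arcs_symmetric by (auto simp: out_arcs_def)
      moreover have "card {(s, t), (s, t'), (s, z)} = 3"
        using \<open>t \<noteq> t'\<close> z_ne[of t] z_ne[of t'] imm_path[OF t] imm_path[OF t'] V by auto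
      moreover have "finite (out_arcs (with_proj G) s)"
        by (rule finite_subset[OF _ pair_finite_arcs]) (auto simp: out_arcs_def)
      ultimately have "3 \<le> out_degree (with_proj G) s"
        unfolding out_degree_def by (metis card_mono)
      then show False using deg[OF V(1) \<open>s \<noteq> r\<close>] by simp
    qed
  qed
qed

lemma fan_spider:
  assumes "fan G r" and card: "\<And>b. b \<in> branches G r \<Longrightarrow> card b = Suc k"
    and "points A = pverts G"
    and RA: "relR A = {(s, t). s \<in> points A \<and> t \<in> points A \<and> (s = t \<or> imm_succ G r s t)}"
    and bs: "distinct bs" "set bs = branches G r"
    and SA: "relS A = {(x, y). x \<in> points A \<and> y \<in> points A \<and>
          (\<exists>i j. i \<le> j \<and> j < length bs \<and> x \<in> bs ! i \<and> y \<in> bs ! j)}"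
  shows "\<exists>v. spider (length bs) k v A"
proof -
  interpret tree_order "pverts G" "tree_le G r" r by (rule fan_tree_order[OF assms(1)])
  have "br = branches G r" by (simp add: br_def branches_def)
  then show ?thesis
    using tree_order_spider[of k bs A] assms by (simp add: imm_succ_def)
qed

lemma F_less_spider:
  assumes "A \<in> F_less"
  shows "\<exists>n k v. spider n k v A"
proof -
  obtain G r bs where G: "fan G r" "points A = pverts G"
    and hts: "\<forall>a \<in> branches G r. \<forall>b \<in> branches G r. height a = height b"
    and RA: "relR A = {(s, t). s \<in> points A \<and> t \<in> points A \<and> (s = t \<or> imm_succ G r s t)}"
    and bs: "distinct bs" "set bs = branches G r"
    and SA: "relS A = {(x, y). x \<in> points A \<and> y \<in> points A \<and>
          (\<exists>i j. i \<le> j \<and> j < length bs \<and> x \<in> bs ! i \<and> y \<in> bs ! j)}"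
    using assms unfolding F_less_def by blast
  interpret tree_order "pverts G" "tree_le G r" r by (rule fan_tree_order[OF G(1)])
  have br: "br = branches G r" by (simp add: br_def branches_def)
  obtain b0 where b0: "b0 \<in> br" using br_ex[OF root(1)] by blast
  \<comment> \<open>\<open>height\<close> subtracts with truncation, so the cardinality is recovered
    only after the branch is known to be nonempty.\<close>
  have "card b = Suc (height b0)" if "b \<in> branches G r" for b
  proof -
    have "b \<in> br" using that by (simp add: br)
    then have "finite b" "b \<noteq> {}"
      using finite_subset[OF br_chain(1) finite_V] br_root by auto
    then have "0 < card b" by (simp add: card_gt_0_iff)
    moreover have "height b = height b0" using hts that b0 br by blast
    ultimately show ?thesis by (simp add: height_def)
  qed
  from fan_spider[OF G(1) this G(2) RA bs SA] show ?thesis by blast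
qed

section \<open>Fans with prescribed width and height\<close>

lemma (in pair_graph) awalk_nth:
  assumes "awalk u p v" "i < length p"
  shows "p ! i = (pawalk_verts u p ! i, pawalk_verts u p ! Suc i)"
  using assms
proof (induction p arbitrary: u i)
  case (Cons e p)
  have e: "fst e = u" "awalk (snd e) p v" using Cons.prems(1) by (auto simp: awalk_Cons_iff)
  show ?case
  proof (cases i)
    case 0
    have "pawalk_verts (snd e) p ! 0 = snd e" by (cases p) (use e(2) in \<open>auto simp: awalk_Cons_iff\<close>)
    then show ?thesis using 0 by (simp add: prod_eq_iff)
  next
    case (Suc i')
    then show ?thesis using Cons.IH[OF e(2), of i'] Cons.prems(2) by simp
  qed
qed simp

text \<open>In a cycle, both neighbours of a vertex of maximal height \<open>d\<close> would be its parent.\<close>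

lemma (in pair_graph) acyclicI_parent:
  fixes d :: "'a \<Rightarrow> nat"
  assumes parent: "\<And>x y. (x, y) \<in> parcs G \<Longrightarrow>
    d y = Suc (d x) \<and> par y = x \<or> d x = Suc (d y) \<and> par x = y"
  shows "undirected_acyclic G"
proof -
  have False if cyc: "cycle p" and len: "length p \<ge> 3" for p
  proof -
    obtain u where w: "awalk u p u" and dist: "distinct (tl (pawalk_verts u p))"
      using cyc by (auto simp: cycle_def)
    define L where "L = length p"
    define x where "x i = pawalk_verts u p ! i" for i
    have lenv: "length (pawalk_verts u p) = Suc L" by (simp add: length_awalk_verts L_def)
    have x0: "x 0 = u" "x L = u"
      using awhd_of_awalk[OF w] awlast_of_awalk[OF w] lenv
      by (auto simp: x_def hd_conv_nth last_conv_nth)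
    have arc: "(x i, x (Suc i)) \<in> parcs G" if "i < L" for i
      using awalk_nth[OF w, of i] that w nth_mem[of i p] by (auto simp: x_def L_def)
    have inj: "i = j" if "x i = x j" "1 \<le> i" "i \<le> L" "1 \<le> j" "j \<le> L" for i j
    proof -
      have "tl (pawalk_verts u p) ! (i - 1) = tl (pawalk_verts u p) ! (j - 1)"
        using that lenv by (simp add: nth_tl x_def)
      then have "i - 1 = j - 1" using dist that lenv by (subst (asm) nth_eq_iff_index_eq) auto
      then show ?thesis using that by simp
    qed
    \<comment> \<open>Position 0 repeats position \<open>L\<close>; only positions 1 to
      \<open>L\<close> carry distinct vertices.\<close>
    have "Max ((\<lambda>i. d (x i)) ` {1..L}) \<in> (\<lambda>i. d (x i)) ` {1..L}"
      using len by (intro Max_in) (auto simp: L_def)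
    then obtain i where i: "1 \<le> i" "i \<le> L" and "d (x i) = Max ((\<lambda>i. d (x i)) ` {1..L})" by auto
    then have imax: "d (x j) \<le> d (x i)" if "1 \<le> j" "j \<le> L" for j using that by simp
    \<comment> \<open>Neighbouring positions are taken cyclically within 1 to \<open>L\<close>;
      length at least 3 makes them different.\<close>
    define prev where "prev = (if i = 1 then L else i - 1)"
    define nxt where "nxt = (if i = L then 1 else Suc i)"
    have pn: "1 \<le> prev" "prev \<le> L" "1 \<le> nxt" "nxt \<le> L" "prev \<noteq> nxt"
      using i len by (auto simp: prev_def nxt_def L_def)
    have "x prev = x (i - 1)" using x0 by (auto simp: prev_def)
    then have "(x prev, x i) \<in> parcs G" using arc[of "i - 1"] i by auto
    then have 1: "par (x i) = x prev" using parent imax[OF pn(1,2)] by fastforce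
    have "(x i, x nxt) \<in> parcs G"
    proof (cases "i = L")
      case True
      have "0 < L" using i by simp
      then have "(x 0, x (Suc 0)) \<in> parcs G" by (rule arc)
      then show ?thesis using x0 True by (simp add: nxt_def)
    next
      case False
      then show ?thesis using arc[of i] i(2) by (simp add: nxt_def)
    qed
    then have "par (x i) = x nxt" using parent imax[OF pn(3,4)] by fastforce
    then show False using 1 inj[of prev nxt] pn by auto
  qed
  then show ?thesis by (auto simp: undirected_acyclic_def)
qed

text \<open>The fan \<open>C\<close> has to live on \<open>nat\<close>. The code 0 is the root
  shared by all legs, and \<open>Suc\<close> keeps the other codes away from it.\<close>

definition enc :: "nat \<Rightarrow> nat \<Rightarrow> nat" where
  "enc i j = (if j = 0 then 0 else Suc (prod_encode (i, j)))"

lemma enc_eq_iff: "enc i j = enc i' j' \<longleftrightarrow> j = j' \<and> (j = 0 \<or> i = i')"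
  by (auto simp: enc_def)

definition fan_graph :: "nat \<Rightarrow> nat \<Rightarrow> nat pair_pre_digraph" where
  "fan_graph N M = \<lparr>pverts = {enc i j | i j. i < N \<and> j \<le> M},
     parcs = {(enc i j, enc i (Suc j)) | i j. i < N \<and> j < M} \<union>
       {(enc i (Suc j), enc i j) | i j. i < N \<and> j < M}\<rparr>"

lemma fan_graph_intros:
  "i < N \<Longrightarrow> j \<le> M \<Longrightarrow> enc i j \<in> pverts (fan_graph N M)"
  "i < N \<Longrightarrow> j < M \<Longrightarrow> (enc i j, enc i (Suc j)) \<in> parcs (fan_graph N M)"
  "i < N \<Longrightarrow> j < M \<Longrightarrow> (enc i (Suc j), enc i j) \<in> parcs (fan_graph N M)"
  unfolding fan_graph_def by auto

lemma fan_graph_arc_cases: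
  assumes "e \<in> parcs (fan_graph N M)"
  obtains i j where "i < N" "j < M" "e = (enc i j, enc i (Suc j)) \<or> e = (enc i (Suc j), enc i j)"
  using assms by (auto simp: fan_graph_def)

lemma pair_graph_fan_graph: "pair_graph (fan_graph N M)"
proof
  show *: "fst e \<in> pverts (fan_graph N M)" "snd e \<in> pverts (fan_graph N M)"
    if "e \<in> parcs (fan_graph N M)" for e
    using fan_graph_arc_cases[OF that] by (metis Suc_leI fan_graph_intros(1) fst_conv less_imp_le_nat snd_conv)+
  have "pverts (fan_graph N M) = (\<lambda>(i, j). enc i j) ` ({..<N} \<times> {..M})"
    by (auto simp: fan_graph_def)
  then show fin: "finite (pverts (fan_graph N M))" by simp
  have "parcs (fan_graph N M) \<subseteq> pverts (fan_graph N M) \<times> pverts (fan_graph N M)"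
    using * by (auto simp: mem_Times_iff)
  then show "finite (parcs (fan_graph N M))"
    using fin by (meson finite_SigmaI finite_subset)
  show "fst e \<noteq> snd e" if "e \<in> parcs (fan_graph N M)" for e
    using that by (auto simp: fan_graph_def enc_eq_iff)
  show "symmetric (with_proj (fan_graph N M))"
    by (auto simp: symmetric_def sym_def fan_graph_def)
qed

primrec leg_path :: "nat \<Rightarrow> nat \<Rightarrow> (nat \<times> nat) list" where
  "leg_path i 0 = []"
| "leg_path i (Suc j) = (enc i (Suc j), enc i j) # leg_path i j"

lemma leg_path:
  assumes "i < N" "j \<le> M"
  shows "pre_digraph.apath (with_proj (fan_graph N M)) (enc i j) (leg_path i j) 0 \<and>
    set (pawalk_verts (enc i j) (leg_path i j)) = enc i ` {..j}"
proof -
  interpret pair_graph "fan_graph N M" by (rule pair_graph_fan_graph)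
  show ?thesis using assms(2)
  proof (induction j)
    case 0
    have "enc i 0 \<in> pverts (fan_graph N M)" using assms(1) by (intro fan_graph_intros) auto
    then show ?case by (simp add: apath_Nil_iff enc_def)
  next
    case (Suc j)
    have arc: "(enc i (Suc j), enc i j) \<in> parcs (fan_graph N M)"
      using assms(1) Suc.prems by (intro fan_graph_intros) auto
    have "enc i (Suc j) \<notin> enc i ` {..j}" by (auto simp: enc_eq_iff)
    then have "apath (enc i (Suc j)) (leg_path i (Suc j)) 0"
      using Suc arc by (auto simp: apath_Cons_iff)
    moreover have "set (pawalk_verts (enc i (Suc j)) (leg_path i (Suc j))) = enc i ` {..Suc j}"
      using Suc by (auto simp: atMost_Suc)
    ultimately show ?case by blast
  qed
qed

lemma fan_fan_graph:
  assumes "1 \<le> N"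
  shows "fan (fan_graph N M) 0"
proof -
  interpret pair_graph "fan_graph N M" by (rule pair_graph_fan_graph)
  have "enc 0 0 \<in> pverts (fan_graph N M)" using assms by (intro fan_graph_intros) auto
  then have rV: "0 \<in> pverts (fan_graph N M)" by (simp add: enc_def)
  \<comment> \<open>\<open>d\<close> and \<open>par\<close> decode height and parent;
    \<open>x - 1\<close> undoes the \<open>Suc\<close> of \<open>enc\<close>.\<close>
  define d where "d x = (if x = 0 then 0 else snd (prod_decode (x - 1)))" for x
  define par where "par x = enc (fst (prod_decode (x - 1))) (d x - 1)" for x
  have d: "d (enc i j) = j" and par: "par (enc i (Suc j)) = enc i j" for i j
    by (simp_all add: d_def par_def enc_def)
  have acyc: "undirected_acyclic (fan_graph N M)"
    by (rule acyclicI_parent[of d par]) (auto simp: fan_graph_def d par)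
  have to_root: "\<exists>p. awalk x p 0" if "x \<in> pverts (fan_graph N M)" for x
  proof -
    obtain i j where "x = enc i j" "i < N" "j \<le> M" using \<open>x \<in> _\<close> by (auto simp: fan_graph_def)
    then show ?thesis using leg_path[of i N j M] by (auto simp: apath_def)
  qed
  have "x \<rightarrow>\<^sup>*\<^bsub>fan_graph N M\<^esub> y" if "x \<in> pverts (fan_graph N M)" "y \<in> pverts (fan_graph N M)" for x y
  proof -
    obtain p q where "awalk x p 0" "awalk y q 0" using to_root \<open>x \<in> _\<close> \<open>y \<in> _\<close> by blast
    then have "awalk x (p @ rev_path q) y" by (intro awalk_appendI) auto
    then show ?thesis by (rule reachable_awalkI)
  qed
  then have "connected (with_proj (fan_graph N M))"
    using rV by (auto simp: connected_def strongly_connected_def reachable_mk_symmetricI)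
  moreover have "out_degree (with_proj (fan_graph N M)) x \<le> 2"
    if x: "x \<in> pverts (fan_graph N M)" "x \<noteq> 0" for x
  proof -
    obtain i j where ij: "x = enc i j" "i < N" "j \<le> M" using x by (auto simp: fan_graph_def)
    have "j \<noteq> 0" using x(2) unfolding ij(1) by (cases j) (auto simp: enc_def)
    then have "out_arcs (with_proj (fan_graph N M)) x \<subseteq> {(x, enc i (Suc j)), (x, enc i (j - 1))}"
      by (auto simp: out_arcs_def fan_graph_def ij enc_eq_iff)
    then have "card (out_arcs (with_proj (fan_graph N M)) x) \<le> card {(x, enc i (Suc j)), (x, enc i (j - 1))}"
      by (intro card_mono) auto
    also have "\<dots> \<le> 2" by (simp add: card_insert_if)
    finally show ?thesis by (simp add: out_degree_def)
  qed
  ultimately show ?thesis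
    using acyc rV pair_graph_fan_graph by (auto simp: fan_def)
qed

lemma tree_le_fan_graph:
  assumes "1 \<le> N"
  shows "tree_le (fan_graph N M) 0 s t \<longleftrightarrow> (\<exists>i j j'. s = enc i j \<and> t = enc i j' \<and> i < N \<and> j \<le> j' \<and> j' \<le> M)"
proof -
  interpret pair_graph "fan_graph N M" by (rule pair_graph_fan_graph)
  have acyc: "undirected_acyclic (fan_graph N M)" using fan_fan_graph[OF assms] by (simp add: fan_def)
  show ?thesis
  proof
    assume "tree_le (fan_graph N M) 0 s t"
    then obtain p where p: "apath t p 0" "s \<in> set (pawalk_verts t p)" by (auto simp: tree_le_def)
    then have "t \<in> pverts (fan_graph N M)" by (auto simp: apath_def)
    then obtain i j' where t: "t = enc i j'" "i < N" "j' \<le> M" by (auto simp: fan_graph_def)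
    then have "p = leg_path i j'" using apath_unique[OF acyc p(1)] leg_path[of i N j' M] by blast
    then have "s \<in> enc i ` {..j'}" using leg_path[of i N j' M] p(2) t by auto
    then show "\<exists>i j j'. s = enc i j \<and> t = enc i j' \<and> i < N \<and> j \<le> j' \<and> j' \<le> M" using t by auto
  next
    assume "\<exists>i j j'. s = enc i j \<and> t = enc i j' \<and> i < N \<and> j \<le> j' \<and> j' \<le> M"
    then obtain i j j' where *: "s = enc i j" "t = enc i j'" "i < N" "j \<le> j'" "j' \<le> M" by blast
    then have "s \<in> set (pawalk_verts t (leg_path i j'))" using leg_path[of i N j' M] by auto
    then show "tree_le (fan_graph N M) 0 s t"
      using leg_path[of i N j' M] * by (auto simp: tree_le_def)
  qed
qed

text \<open>A vertex comparable with a non-root vertex of a leg lies on that leg, so every chain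
  fits into one leg. Legs are maximal because the tip of one lies on no other.\<close>

lemma branches_fan_graph:
  assumes "1 \<le> N" "1 \<le> M"
  shows "branches (fan_graph N M) 0 = (\<lambda>i. enc i ` {..M}) ` {..<N}"
proof -
  define V where "V = pverts (fan_graph N M)"
  define le where "le = tree_le (fan_graph N M) 0"
  have le: "le s t \<longleftrightarrow> (\<exists>i j j'. s = enc i j \<and> t = enc i j' \<and> i < N \<and> j \<le> j' \<and> j' \<le> M)" for s t
    unfolding le_def by (rule tree_le_fan_graph[OF assms(1)])
  have V: "x \<in> V \<longleftrightarrow> (\<exists>i < N. \<exists>j \<le> M. x = enc i j)" for x
    by (auto simp: V_def fan_graph_def)
  have same: "x \<in> enc i ` {..M}" if "x \<in> V" "i < N" "1 \<le> j" "enc i j = x' " "x = x' \<or> le x x' \<or> le x' x" "j \<le> M" for x x' i j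
    using that by (auto simp: le enc_eq_iff)
  have chain: "pred_on.chain V le (enc i ` {..M})" if "i < N" for i
    unfolding pred_on.chain_def
  proof (intro conjI ballI)
    show "enc i ` {..M} \<subseteq> V" using that V by blast
    fix x y assume "x \<in> enc i ` {..M}" "y \<in> enc i ` {..M}"
    then obtain j j' where "x = enc i j" "y = enc i j'" "j \<le> M" "j' \<le> M" by auto
    then show "le\<^sup>=\<^sup>= x y \<or> le\<^sup>=\<^sup>= y x" using that nat_le_linear[of j j'] by (auto simp: le)
  qed
  have sub: "\<exists>i < N. b \<subseteq> enc i ` {..M}" if b: "pred_on.chain V le b" for b
  proof (cases "b \<subseteq> {enc 0 0}")
    case True
    then show ?thesis using assms by (intro exI[of _ 0]) auto
  next
    case False
    then obtain x where x: "x \<in> b" "x \<noteq> enc 0 0" by auto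
    then have "x \<in> V" using b by (auto simp: pred_on.chain_def)
    then obtain i j where ij: "i < N" "j \<le> M" "x = enc i j" by (auto simp: V)
    then have "1 \<le> j" using x by (cases j) (auto simp: enc_def)
    have "y \<in> enc i ` {..M}" if "y \<in> b" for y
    proof -
      have "y \<in> V" "y = x \<or> le y x \<or> le x y" using b that x(1) by (auto simp: pred_on.chain_def)
      then show ?thesis using same[of y i j x] ij \<open>1 \<le> j\<close> by auto
    qed
    then show ?thesis using ij by blast
  qed
  have max: "pred_on.maxchain V le (enc i ` {..M})" if i: "i < N" for i
    unfolding pred_on.maxchain_def
  proof (intro conjI chain[OF i] notI)
    assume "\<exists>S. pred_on.chain V le S \<and> enc i ` {..M} \<subset> S"
    then obtain S where chS: "pred_on.chain V le S" and S1: "enc i ` {..M} \<subset> S" by (elim exE conjE)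
    obtain i' where "S \<subseteq> enc i' ` {..M}" using sub[OF chS] by (elim exE conjE)
    note S = S1 this
    have "enc i M \<in> enc i' ` {..M}" using S by auto
    then have "i = i'" using assms(2) by (auto simp: enc_eq_iff)
    then show False using S by auto
  qed
  have "pred_on.maxchain V le b \<longleftrightarrow> b \<in> (\<lambda>i. enc i ` {..M}) ` {..<N}" for b
  proof
    assume b: "pred_on.maxchain V le b"
    then obtain i where "i < N" "b \<subseteq> enc i ` {..M}" using sub[of b] by (auto simp: pred_on.maxchain_def)
    then have "b = enc i ` {..M}" using b chain[of i] by (auto simp: pred_on.maxchain_def)
    then show "b \<in> (\<lambda>i. enc i ` {..M}) ` {..<N}" using \<open>i < N\<close> by auto
  qed (use max in auto)
  then show ?thesis by (auto simp: branches_def V_def le_def)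
qed

lemma F_less_ex:
  assumes "1 \<le> N" "1 \<le> M"
  shows "\<exists>(C :: nat RS_structure) v. C \<in> F_less \<and> spider N M v C"
proof -
  define G where "G = fan_graph N M"
  define bs where "bs = map (\<lambda>i. enc i ` {..M}) [0..<N]"
  define C where "C = \<lparr>points = pverts G,
    relR = {(s, t). s \<in> pverts G \<and> t \<in> pverts G \<and> (s = t \<or> imm_succ G 0 s t)},
    relS = {(x, y). x \<in> pverts G \<and> y \<in> pverts G \<and>
          (\<exists>i j. i \<le> j \<and> j < length bs \<and> x \<in> bs ! i \<and> y \<in> bs ! j)}\<rparr>"
  have G: "fan G 0" using fan_fan_graph[OF assms(1)] by (simp add: G_def)
  have br: "branches G 0 = (\<lambda>i. enc i ` {..M}) ` {..<N}"
    using branches_fan_graph[OF assms] by (simp add: G_def)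
  have card: "card b = Suc M" if "b \<in> branches G 0" for b
  proof -
    have "inj_on (enc i) {..M}" for i by (auto simp: inj_on_def enc_eq_iff)
    then show ?thesis using that by (auto simp: br card_image)
  qed
  \<comment> \<open>As \<open>M\<close> is positive, the tip identifies the leg.\<close>
  have "inj_on (\<lambda>i. enc i ` {..M}) {..<N}"
  proof
    fix i i' assume "enc i ` {..M} = enc i' ` {..M}"
    then have "enc i M \<in> enc i' ` {..M}" by auto
    then show "i = i'" using assms(2) by (auto simp: enc_eq_iff)
  qed
  then have bs: "distinct bs" "set bs = branches G 0"
    by (simp_all add: bs_def br distinct_map atLeast0LessThan)
  have "\<exists>v. spider (length bs) M v C"
    by (rule fan_spider[OF G card _ _ bs]) (simp_all add: C_def)
  moreover have "C \<in> F_less"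
    unfolding F_less_def
    using G bs card by (intro CollectI exI[of _ G] exI[of _ 0])
      (auto simp: C_def height_def intro!: exI[of _ bs])
  ultimately show ?thesis by (auto simp: bs_def)
qed

section \<open>Transfer from words to fans\<close>

theorem theorem2p6:
  fixes A :: "'a RS_structure" and B :: "'b RS_structure" and r :: nat
  assumes "A \<in> F_less" and "B \<in> F_less" and "r \<ge> 2"
  shows "\<exists>C :: nat RS_structure. C \<in> F_less \<and>
    (\<forall>c :: (nat \<Rightarrow> 'a) \<Rightarrow> nat. c \<in> epis C A \<rightarrow> {..<r} \<longrightarrow>
      (\<exists>g \<in> epis C B. monochromatic c {compose (points C) f g | f. f \<in> epis B A}))"
proof (rule ccontr)
  assume contra: "\<not> ?thesis"
  obtain n k vA where A: "spider n k vA A" using F_less_spider[OF assms(1)] by blast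
  obtain m K vB where B: "spider m K vB B" using F_less_spider[OF assms(2)] by blast
  \<comment> \<open>One parameter serves as width and height; the successor makes both
    positive.\<close>
  have "\<exists>(C :: nat RS_structure) v. C \<in> F_less \<and> spider (Suc N) (Suc N) v C" for N
    by (rule F_less_ex) auto
  then obtain C :: "nat \<Rightarrow> nat RS_structure" and vC
    where CF: "\<And>N. C N \<in> F_less" and C: "\<And>N. spider (Suc N) (Suc N) (vC N) (C N)"
    by metis
  have "\<forall>N. \<exists>c :: (nat \<Rightarrow> 'a) \<Rightarrow> nat. c \<in> epis (C N) A \<rightarrow> {..<r} \<and>
      (\<forall>g \<in> epis (C N) B. \<not> monochromatic c {compose (points (C N)) f g | f. f \<in> epis B A})"
    using contra CF by blast
  from choice[OF this] obtain c :: "nat \<Rightarrow> (nat \<Rightarrow> 'a) \<Rightarrow> nat"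
    where "\<forall>N. c N \<in> epis (C N) A \<rightarrow> {..<r} \<and>
      (\<forall>g \<in> epis (C N) B. \<not> monochromatic (c N) {compose (points (C N)) f g | f. f \<in> epis B A})"
    by (rule exE)
  then have c: "\<And>N. c N \<in> epis (C N) A \<rightarrow> {..<r}"
    and bad: "\<And>N g. g \<in> epis (C N) B \<Longrightarrow>
      \<not> monochromatic (c N) {compose (points (C N)) f g | f. f \<in> epis B A}"
    by simp_all
  define epiA where "epiA N y = word_epi (C N) (vC N) (Suc N) (Suc N) vA y" for N y
  \<comment> \<open>The default colour 0 makes \<open>col\<close> total and bounded by
    \<open>r\<close> also on words that give no epimorphism.\<close>
  define col where "col N y = (if epiA N y \<in> epis (C N) A then c N (epiA N y) else 0)" for N y
  have col: "col N y < r" for N y using c[of N] assms(3) by (auto simp: col_def)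
  obtain \<sigma> where \<sigma>: "\<And>f. f \<in> epis B A \<Longrightarrow> length (\<sigma> f) = m \<and> valid_letters n k K (\<sigma> f) \<and>
      (\<forall>b < m. \<forall>j \<le> K. f (vB b j) = vA (fst (\<sigma> f ! b)) (snd (\<sigma> f ! b) j))"
    using epi_letters[OF B A] by metis
  have fin: "finite (epis B A)"
  proof (rule finite_subset)
    have "points B = (\<lambda>(i, j). vB i j) ` ({..<m} \<times> {..K})" "points A = (\<lambda>(i, j). vA i j) ` ({..<n} \<times> {..k})"
      using spiderD(4)[OF A] spiderD(4)[OF B] by auto
    then show "finite (points B \<rightarrow>\<^sub>E points A)" by (intro finite_PiE) auto
    show "epis B A \<subseteq> points B \<rightarrow>\<^sub>E points A" by (auto simp: epis_def PiE_def)
  qed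
  \<comment> \<open>The sum of leg count and height bounds both, so the joined word fits into
    \<open>C N\<close>.\<close>
  obtain xs N \<gamma> where xs: "length xs = m" "\<forall>x \<in> set xs. good_word K x"
    and N: "length (fst (join_blocks xs)) + snd (join_blocks xs) \<le> N"
    and \<gamma>: "\<forall>\<tau> \<in> \<sigma> ` epis B A. col N (apply_letters \<tau> xs) = \<gamma>"
    using word_ramsey[of col r "\<sigma> ` epis B A" n m k K
        "\<lambda>xs. length (fst (join_blocks xs)) + snd (join_blocks xs)"]
      col fin spiderD(1)[OF A] \<sigma> by blast
  define y where "y = join_blocks xs"
  have y: "valid_word m K y" using valid_join_blocks[OF xs(2)] xs(1) by (simp add: y_def)
  define g where "g = word_epi (C N) (vC N) (Suc N) (Suc N) vB y"
  have g: "g \<in> epis (C N) B"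
    unfolding g_def by (rule word_epi_in_epis[OF C B y]) (use N in \<open>auto simp: y_def\<close>)
  have "c N (compose (points (C N)) f g) = \<gamma>" if f: "f \<in> epis B A" for f
  proof -
    have len: "length (\<sigma> f) = m" and val: "valid_letters n k K (\<sigma> f)"
      and f_eq: "\<And>b j. b < m \<Longrightarrow> j \<le> K \<Longrightarrow> f (vB b j) = vA (fst (\<sigma> f ! b)) (snd (\<sigma> f ! b) j)"
      using \<sigma>[OF f] by auto
    have rel: "apply_letters (\<sigma> f) xs = relabel (\<lambda>b. \<sigma> f ! b) y"
      using relabel_join_blocks[of xs "\<sigma> f"] xs(1) len by (simp add: y_def)
    have comp: "compose (points (C N)) f g \<in> epis (C N) A" by (rule epis_compose[OF g f])
    have "f (word_map vB y i j) = word_map vA (apply_letters (\<sigma> f) xs) i j" for i j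
    proof (cases "i < length (fst y)")
      case True
      obtain b q where bq: "fst y ! i = (b, q)" by fastforce
      then have "(b, q) \<in> set (fst y)" using nth_mem[OF True] by simp
      then have "b < m" "q j \<le> K" using y by (auto simp: valid_word_def)
      then show ?thesis using True f_eq by (simp add: word_map_def rel relabel_def bq)
    next
      case False
      \<comment> \<open>On a surplus branch \<open>g\<close> takes the root of \<open>B\<close> as
        its value, and \<open>f\<close> maps root to root.\<close>
      have m: "0 < m" using spiderD(1)[OF B] by simp
      then have "\<sigma> f ! 0 \<in> set (\<sigma> f)" using len by simp
      then have "fst (\<sigma> f ! 0) < n" "snd (\<sigma> f ! 0) 0 = 0"
        using val by (auto simp: valid_letters_def step_fun_def)
      then have "f (vB 0 0) = vA 0 0"
        using f_eq[OF m, of 0] spiderD(3)[OF A, of "fst (\<sigma> f ! 0)" 0 0 0] by simp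
      then show ?thesis using False by (simp add: word_map_def rel relabel_def)
    qed
    \<comment> \<open>Both maps decode a point of \<open>C N\<close> by the same choice of
      coordinates, so agreement for all coordinates gives equality of functions.\<close>
    then have "epiA N (apply_letters (\<sigma> f) xs) = compose (points (C N)) f g"
      by (auto simp: epiA_def g_def word_epi_def compose_def fun_eq_iff Let_def case_prod_unfold)
    then show ?thesis using \<gamma> f comp by (auto simp: col_def)
  qed
  then have "monochromatic (c N) {compose (points (C N)) f g | f. f \<in> epis B A}"
    by (auto simp: monochromatic_def)
  then show False using bad[OF g] by simp
qed

end
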